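(* Let $f,g,h,p$ satisfy the standing assumption (a)--(d), suppose $\Psi=f+g+h+p$ has bounded level sets, $L_f+L_h>0$, $\beta\in(0,\rho_p^{-1}]$, and $(\tau,\alpha)$ is an admissible pair (as defined in the context). Let $\{(x^k,y^k,z^k)\}$ be generated by the algorithm with these parameters, and let $(x^*,y^*,z^* )$ be an accumulation point of $\{(x^k,y^k,z^k)\}$. Then $x^*=y^*$ and $(y^*,z^* )\in\mathrm{Fix}(T_\Lambda)$.
   Context: Notation. $\mathbb R^n$ carries the Euclidean inner product and norm. A function is $L$-smooth if it is continuously differentiable with $L$-Lipschitz gradient; $\phi$ is $\rho$-weakly convex ($\rho\ge0$) if $\phi+\frac{\rho}{2}\|\cdot\|^2$ is convex, and $\sigma$-strongly convex ($\sigma>0$) if $\phi-\frac\sigma2\|\cdot\|^2$ is convex. $\partial\phi$ denotes the limiting (Mordukhovich) subdifferential: $\xi\in\partial\phi(x)$ iff there are $x^k\to x$ with $\phi(x^k)\to\phi(x)$ and $\xi^k\to\xi$ with $\liminf_{\bar x\to x^k,\bar x\ne x^k}\frac{\phi(\bar x)-\phi(x^k)-\langle\xi^k,\bar x-x^k\rangle}{\|\bar x-x^k\|}\ge0$ for each $k$. The proximal mapping is $\mathrm{prox}_{\gamma\phi}(x)=\arg\min_w\{\phi(w)+\frac1{2\gamma}\|w-x\|^2\}$ (set-valued). Standing assumption. (a) $f:\mathbb R^n\to\mathbb R$ is $L_f$-smooth and proximable; (b) $g:\mathbb R^n\to(-\infty,\infty]$ is proper, closed (lower semicontinuous) and proximable;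 (c) $h:\mathbb R^n\to\mathbb R$ is $L_h$-smooth; (d) $p:\mathbb R^n\to\mathbb R$ is continuous on an open set containing $\mathrm{dom}(g)$ and $-p$ is $\rho_p$-weakly convex, $\rho_p\ge0$. ("Proximable" informally means that the proximal mapping is easily computable.) Conventions: $a/\infty=0$, $a/0=\infty$ for $a\ne0$, $\infty/\infty=1$; so $\rho_p^{-1}=\infty$ if $\rho_p=0$, in which case $\beta=\infty$ is allowed. Algorithm. Parameters: $\tau>0$, $\alpha\in(0,\infty)$, $\beta\in(0,\infty]$, $\gamma\in(0,\infty)$ with $\frac1\gamma=\frac1\alpha+\frac1\beta$; $\Lambda=(\alpha,\beta,\gamma)$. Starting from $(y^0,z^0)\in\mathbb R^n\times\mathbb R^n$, for all $k\ge0$: $x^k\in\mathrm{prox}_{\alpha f}(z^k)$; $y^{k+1}\in\mathrm{prox}_{\gamma g}\big(\frac\gamma\alpha(2x^k-z^k-\alpha\nabla h(x^k))+\frac\gamma\beta y^k-\gamma\xi^k\big)$ for some $\xi^k\in\partial p(y^k)$; $z^{k+1}=z^k+\tau(y^{k+1}-x^k)$. Fixed-point operator. $P_\Lambda(y,z):=\bigcup\big\{\mathrm{prox}_{\gamma g}\big(\frac\gamma\alpha(2x-z-\alpha\nabla h(x))+\frac\gamma\beta y-\gamma\xi\big): x\in\mathrm{prox}_{\alpha f}(z),\ \xi\in\partial p(y)\big\}$ and $T_\Lambda(y,z):=\{(y^+,\,z+\tau(y^+-\mathrm{prox}_{\alpha f}(z))): y^+\in P_\Lambda(y,z)\}$ (here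 $\mathrm{prox}_{\alpha f}$ is single-valued because $\alpha<1/L_f$). $\mathrm{Fix}(T_\Lambda)$ is the set of $(y,z)$ with $(y,z)\in T_\Lambda(y,z)$. Admissible pairs. Fix $\rho_f\in[0,L_f]$ such that $f$ is $\rho_f$-weakly convex. The pair $(\tau,\alpha)$, $\tau,\alpha>0$, is admissible if one of the following holds. (A) $\tau\in(0,1]$ and $\alpha\in(0,\bar\alpha)$, where $\bar\alpha=\frac1{L_f+L_h}$ if $(2-\tau)L_f-2\rho_f\ge\tau L_h$, and otherwise $\bar\alpha=\frac{\tau}{2\eta^*}$ with $\eta^*$ the positive root of $2(2-\tau)\eta^2-\tau((2-\tau)L_h+\rho_f\tau)\eta-\tau^2(\rho_f^2+L_fL_h)$. (B) $\tau\in(1,2)$ and $\alpha\in(0,\bar\alpha)$, where, for some $\sigma_h\in\mathbb R$ such that $h-\frac{\sigma_h}2\|\cdot\|^2$ is convex, $\bar\alpha_1$ is the positive root of $2L_f(L_f+L_h)\alpha^2+(\tau L_h-2(\tau-1)\sigma_h-\tau L_f)\alpha-(2-\tau)$, $\bar\alpha=\bar\alpha_1$ if $\tau\le2\bar\alpha_1(L_f-\rho_f)$, and otherwise $\bar\alpha=\frac\tau{2\eta^*}$ with $\eta^*$ the positive root of $2(2-\tau)\eta^2-\tau(\tau L_h-2(\tau-1)\sigma_h+\rho_f\tau)\eta-\tau^2(\rho_f^2+L_fL_h)$. (C) $f$ is $\sigma_f$-strongly convex with $\sigma_f>0$, $h$ is $\rho_h$-weakly convex with $\rho_h\in[0,L_h]$,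 and with $\nu=\frac{\sigma_f}{L_f+L_h}$, $\theta_0=\frac{L_h(L_f^2-\sigma_f^2)}{L_f(L_f+L_h)^2}$, $\theta_1=\frac{L_h}{L_f+L_h}$, $\theta_2=\frac{\rho_h}{L_f+L_h}$: $\tau\ge2$ satisfies $(\tau\nu-\tau\theta_1-2(\tau-1)\theta_2)^2-8(\theta_0+\nu)(\tau-2)>0$ and $\tau\nu-\tau\theta_1-2(\tau-1)\theta_2>0$, and $\alpha\in\big(\frac{\tau\mu_*}{2(L_f+L_h)},\frac{\tau\mu^*}{2(L_f+L_h)}\big)\cap\big(0,\frac1{L_f+L_h}\big)$, where $\mu_*<\mu^*$ are the two roots of $\tau^2(\theta_0+\nu)\mu^2-\tau^2(\nu-\theta_1-\frac{2(\tau-1)}\tau\theta_2)\mu+2(\tau-2)$. *)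

theory Defs
  imports "HOL-Analysis.Analysis"
begin

text \<open>Smoothness and curvature of real-valued functions\<close>

definition gradient :: "('a::euclidean_space \<Rightarrow> real) \<Rightarrow> 'a \<Rightarrow> 'a" where
  "gradient f x = (THE D. GDERIV f x :> D)"

text \<open>The constant of \<^const>\<open>lipschitz_on\<close> is nonnegative by definition, so \<open>L \<ge> 0\<close> is implied.\<close>

definition L_smooth :: "real \<Rightarrow> ('a::euclidean_space \<Rightarrow> real) \<Rightarrow> bool" where
  "L_smooth L f \<longleftrightarrow>
     (\<forall>x. \<exists>D. GDERIV f x :> D) \<and> continuous_on UNIV (gradient f) \<and> L-lipschitz_on UNIV (gradient f)"

definition weakly_convex :: "real \<Rightarrow> ('a::euclidean_space \<Rightarrow> real) \<Rightarrow> bool" where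
  "weakly_convex \<rho> \<phi> \<longleftrightarrow> \<rho> \<ge> 0 \<and> convex_on UNIV (\<lambda>x. \<phi> x + \<rho> / 2 * (norm x)\<^sup>2)"

definition strongly_convex :: "real \<Rightarrow> ('a::euclidean_space \<Rightarrow> real) \<Rightarrow> bool" where
  "strongly_convex \<sigma> \<phi> \<longleftrightarrow> \<sigma> > 0 \<and> convex_on UNIV (\<lambda>x. \<phi> x - \<sigma> / 2 * (norm x)\<^sup>2)"


text \<open>Extended-valued functions; a real-valued \<open>f\<close> enters as \<open>\<lambda>x. ereal (f x)\<close>\<close>

definition domain :: "('a \<Rightarrow> ereal) \<Rightarrow> 'a set" where
  "domain \<phi> = {x. \<phi> x < \<infinity>}"

definition proper :: "('a \<Rightarrow> ereal) \<Rightarrow> bool" where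
  "proper \<phi> \<longleftrightarrow> (\<forall>x. \<phi> x \<noteq> -\<infinity>) \<and> domain \<phi> \<noteq> {}"

definition lower_semicontinuous :: "('a::topological_space \<Rightarrow> ereal) \<Rightarrow> bool" where
  "lower_semicontinuous \<phi> \<longleftrightarrow> (\<forall>x. \<phi> x \<le> Liminf (at x) \<phi>)"

definition bounded_level_sets :: "('a::metric_space \<Rightarrow> ereal) \<Rightarrow> bool" where
  "bounded_level_sets \<phi> \<longleftrightarrow> (\<forall>c::real. bounded {x. \<phi> x \<le> ereal c})"

definition prox :: "real \<Rightarrow> ('a::euclidean_space \<Rightarrow> ereal) \<Rightarrow> 'a \<Rightarrow> 'a set" where
  "prox \<gamma> \<phi> x =
     {w. is_arg_min (\<lambda>u. \<phi> u + ereal (1 / (2 * \<gamma>) * (norm (u - x))\<^sup>2)) (\<lambda>_. True) w}"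

text \<open>Both subdifferentials are empty where the function is not finite; this keeps
  \<open>\<infinity> - \<infinity>\<close> out of the difference quotient.\<close>

definition regular_subdifferential :: "('a::euclidean_space \<Rightarrow> ereal) \<Rightarrow> 'a \<Rightarrow> 'a set" where
  "regular_subdifferential \<phi> x =
     {\<xi>. \<bar>\<phi> x\<bar> \<noteq> \<infinity> \<and>
          0 \<le> Liminf (at x)
                 (\<lambda>y. (\<phi> y - \<phi> x - ereal (\<xi> \<bullet> (y - x))) / ereal (norm (y - x)))}"

definition limiting_subdifferential :: "('a::euclidean_space \<Rightarrow> ereal) \<Rightarrow> 'a \<Rightarrow> 'a set" where
  "limiting_subdifferential \<phi> x =
     {\<xi>. \<bar>\<phi> x\<bar> \<noteq> \<infinity> \<and>
          (\<exists>X \<Xi>. X \<longlonglongrightarrow> x \<and> (\<lambda>k. \<phi> (X k)) \<longlonglongrightarrow> \<phi> x \<and> \<Xi> \<longlonglongrightarrow> \<xi> \<and>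
                 (\<forall>k. \<Xi> k \<in> regular_subdifferential \<phi> (X k)))}"


text \<open>The splitting algorithm and its fixed-point operator\<close>

text \<open>The argument of \<open>prox \<gamma> g\<close> in the \<open>y\<close>-update. For \<open>\<beta> = \<infinity>\<close> the quotient
  \<open>ereal \<gamma> / \<beta>\<close> is \<open>0\<close>; for \<open>0 < \<beta> < \<infinity>\<close> it is the real quotient.\<close>

definition forward_point ::
  "('a::euclidean_space \<Rightarrow> real) \<Rightarrow> real \<Rightarrow> ereal \<Rightarrow> real \<Rightarrow> 'a \<Rightarrow> 'a \<Rightarrow> 'a \<Rightarrow> 'a \<Rightarrow> 'a" where
  "forward_point h \<alpha> \<beta> \<gamma> x y z \<xi> =
     (\<gamma> / \<alpha>) *\<^sub>R (2 *\<^sub>R x - z - \<alpha> *\<^sub>R gradient h x)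
     + real_of_ereal (ereal \<gamma> / \<beta>) *\<^sub>R y - \<gamma> *\<^sub>R \<xi>"

definition generated_sequence ::
  "('a::euclidean_space \<Rightarrow> real) \<Rightarrow> ('a \<Rightarrow> ereal) \<Rightarrow> ('a \<Rightarrow> real) \<Rightarrow> ('a \<Rightarrow> real) \<Rightarrow>
   real \<Rightarrow> real \<Rightarrow> ereal \<Rightarrow> real \<Rightarrow> (nat \<Rightarrow> 'a) \<Rightarrow> (nat \<Rightarrow> 'a) \<Rightarrow> (nat \<Rightarrow> 'a) \<Rightarrow> bool" where
  "generated_sequence f g h p \<tau> \<alpha> \<beta> \<gamma> x y z \<longleftrightarrow>
     (\<forall>k. x k \<in> prox \<alpha> (\<lambda>u. ereal (f u)) (z k) \<and>
          (\<exists>\<xi> \<in> limiting_subdifferential (\<lambda>u. ereal (p u)) (y k).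
             y (Suc k) \<in> prox \<gamma> g (forward_point h \<alpha> \<beta> \<gamma> (x k) (y k) (z k) \<xi>)) \<and>
          z (Suc k) = z k + \<tau> *\<^sub>R (y (Suc k) - x k))"

definition P_op ::
  "('a::euclidean_space \<Rightarrow> real) \<Rightarrow> ('a \<Rightarrow> ereal) \<Rightarrow> ('a \<Rightarrow> real) \<Rightarrow> ('a \<Rightarrow> real) \<Rightarrow>
   real \<Rightarrow> ereal \<Rightarrow> real \<Rightarrow> 'a \<times> 'a \<Rightarrow> 'a set" where
  "P_op f g h p \<alpha> \<beta> \<gamma> = (\<lambda>(y, z).
     \<Union> {prox \<gamma> g (forward_point h \<alpha> \<beta> \<gamma> x y z \<xi>) | x \<xi>.
          x \<in> prox \<alpha> (\<lambda>u. ereal (f u)) z \<and>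
          \<xi> \<in> limiting_subdifferential (\<lambda>u. ereal (p u)) y})"

definition T_op ::
  "('a::euclidean_space \<Rightarrow> real) \<Rightarrow> ('a \<Rightarrow> ereal) \<Rightarrow> ('a \<Rightarrow> real) \<Rightarrow> ('a \<Rightarrow> real) \<Rightarrow>
   real \<Rightarrow> real \<Rightarrow> ereal \<Rightarrow> real \<Rightarrow> 'a \<times> 'a \<Rightarrow> ('a \<times> 'a) set" where
  "T_op f g h p \<tau> \<alpha> \<beta> \<gamma> = (\<lambda>(y, z).
     {(y', z + \<tau> *\<^sub>R (y' - x)) | y' x.
        y' \<in> P_op f g h p \<alpha> \<beta> \<gamma> (y, z) \<and> x \<in> prox \<alpha> (\<lambda>u. ereal (f u)) z})"

definition Fix :: "('b \<Rightarrow> 'b set) \<Rightarrow> 'b set" where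
  "Fix T = {w. w \<in> T w}"


text \<open>Admissible pairs\<close>

definition quadratic_root :: "real \<Rightarrow> real \<Rightarrow> real \<Rightarrow> real \<Rightarrow> bool" where
  "quadratic_root a b c r \<longleftrightarrow> a * r\<^sup>2 + b * r + c = 0"

definition positive_root :: "real \<Rightarrow> real \<Rightarrow> real \<Rightarrow> real \<Rightarrow> bool" where
  "positive_root a b c r \<longleftrightarrow> r > 0 \<and> quadratic_root a b c r"

definition admissible_A :: "real \<Rightarrow> real \<Rightarrow> real \<Rightarrow> real \<Rightarrow> real \<Rightarrow> bool" where
  "admissible_A Lf Lh \<rho>f \<tau> \<alpha> \<longleftrightarrow>
     0 < \<tau> \<and> \<tau> \<le> 1 \<and>
     (\<exists>\<alpha>bar. 0 < \<alpha> \<and> \<alpha> < \<alpha>bar \<and>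
        (if (2 - \<tau>) * Lf - 2 * \<rho>f \<ge> \<tau> * Lh
         then \<alpha>bar = 1 / (Lf + Lh)
         else \<exists>\<eta>. positive_root
                    (2 * (2 - \<tau>))
                    (- (\<tau> * ((2 - \<tau>) * Lh + \<rho>f * \<tau>)))
                    (- (\<tau>\<^sup>2 * (\<rho>f\<^sup>2 + Lf * Lh))) \<eta> \<and>
                  \<alpha>bar = \<tau> / (2 * \<eta>)))"

text \<open>Here \<open>\<sigma>\<close> may have any sign.\<close>

definition admissible_B ::
  "('a::euclidean_space \<Rightarrow> real) \<Rightarrow> real \<Rightarrow> real \<Rightarrow> real \<Rightarrow> real \<Rightarrow> real \<Rightarrow> bool" where
  "admissible_B h Lf Lh \<rho>f \<tau> \<alpha> \<longleftrightarrow>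
     1 < \<tau> \<and> \<tau> < 2 \<and>
     (\<exists>\<sigma> \<alpha>1 \<alpha>bar.
        convex_on UNIV (\<lambda>x. h x - \<sigma> / 2 * (norm x)\<^sup>2) \<and>
        positive_root
          (2 * Lf * (Lf + Lh))
          (\<tau> * Lh - 2 * (\<tau> - 1) * \<sigma> - \<tau> * Lf)
          (- (2 - \<tau>)) \<alpha>1 \<and>
        0 < \<alpha> \<and> \<alpha> < \<alpha>bar \<and>
        (if \<tau> \<le> 2 * \<alpha>1 * (Lf - \<rho>f)
         then \<alpha>bar = \<alpha>1
         else \<exists>\<eta>. positive_root
                    (2 * (2 - \<tau>))
                    (- (\<tau> * (\<tau> * Lh - 2 * (\<tau> - 1) * \<sigma> + \<rho>f * \<tau>)))
                    (- (\<tau>\<^sup>2 * (\<rho>f\<^sup>2 + Lf * Lh))) \<eta> \<and>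
                  \<alpha>bar = \<tau> / (2 * \<eta>)))"

definition admissible_C ::
  "('a::euclidean_space \<Rightarrow> real) \<Rightarrow> ('a \<Rightarrow> real) \<Rightarrow> real \<Rightarrow> real \<Rightarrow> real \<Rightarrow> real \<Rightarrow> bool" where
  "admissible_C f h Lf Lh \<tau> \<alpha> \<longleftrightarrow>
     (\<exists>\<sigma>f \<rho>h. strongly_convex \<sigma>f f \<and> weakly_convex \<rho>h h \<and> \<rho>h \<le> Lh \<and>
        (let \<nu> = \<sigma>f / (Lf + Lh);
             \<theta>0 = Lh * (Lf\<^sup>2 - \<sigma>f\<^sup>2) / (Lf * (Lf + Lh)\<^sup>2);
             \<theta>1 = Lh / (Lf + Lh);
             \<theta>2 = \<rho>h / (Lf + Lh)
         in \<tau> \<ge> 2 \<and>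
            (\<tau> * \<nu> - \<tau> * \<theta>1 - 2 * (\<tau> - 1) * \<theta>2)\<^sup>2 - 8 * (\<theta>0 + \<nu>) * (\<tau> - 2) > 0 \<and>
            \<tau> * \<nu> - \<tau> * \<theta>1 - 2 * (\<tau> - 1) * \<theta>2 > 0 \<and>
            (\<exists>\<mu>1 \<mu>2. \<mu>1 < \<mu>2 \<and>
               (\<forall>\<mu>\<in>{\<mu>1, \<mu>2}. quadratic_root
                  (\<tau>\<^sup>2 * (\<theta>0 + \<nu>))
                  (- (\<tau>\<^sup>2 * (\<nu> - \<theta>1 - 2 * (\<tau> - 1) / \<tau> * \<theta>2)))
                  (2 * (\<tau> - 2)) \<mu>) \<and>
               \<alpha> \<in> {\<tau> * \<mu>1 / (2 * (Lf + Lh)) <..< \<tau> * \<mu>2 / (2 * (Lf + Lh))}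
                   \<inter> {0 <..< 1 / (Lf + Lh)})))"

definition admissible_pair ::
  "('a::euclidean_space \<Rightarrow> real) \<Rightarrow> ('a \<Rightarrow> real) \<Rightarrow> real \<Rightarrow> real \<Rightarrow> real \<Rightarrow> real \<Rightarrow> real \<Rightarrow> bool"
where
  "admissible_pair f h Lf Lh \<rho>f \<tau> \<alpha> \<longleftrightarrow>
     0 < \<tau> \<and> 0 < \<alpha> \<and>
     (admissible_A Lf Lh \<rho>f \<tau> \<alpha> \<or> admissible_B h Lf Lh \<rho>f \<tau> \<alpha> \<or> admissible_C f h Lf Lh \<tau> \<alpha>)"

end

theory Submission
  imports Defs
begin

text \<open>
  Completing the square turns the \<open>y\<close>-update into the minimisation of \<open>g\<close> plus a model that
  linearises \<open>f\<close>, \<open>h\<close> and \<open>p\<close>. Since \<open>1 / \<beta> \<ge> \<rho>\<^sub>p\<close>, the linearisation of \<open>p\<close> together with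
  the proximal term \<open>\<parallel>w - y\<parallel>\<^sup>2 / (2\<beta>)\<close> overestimates \<open>p\<close>, so the update does not increase the merit function
  \<open>f x + h x + (\<nabla>f x + \<nabla>h x) \<bullet> (y - x) + \<parallel>y - x\<parallel>\<^sup>2 / (2\<alpha>) + g y + p y\<close>. Passing from \<open>x\<^sup>k\<close> to
  \<open>x\<^sup>k\<^sup>+\<^sup>1\<close> changes it by at most \<open>- \<kappa> \<parallel>x\<^sup>k\<^sup>+\<^sup>1 - x\<^sup>k\<parallel>\<^sup>2\<close>, and admissibility of \<open>(\<tau>, \<alpha>)\<close> is what makes
  \<open>\<kappa>\<close> positive. Along a convergent subsequence the merit function is bounded below, because \<open>g\<close> is
  lower semicontinuous; being nonincreasing, it is bounded below altogether. Hence
  \<open>x\<^sup>k\<^sup>+\<^sup>1 - x\<^sup>k\<close> and \<open>y\<^sup>k\<^sup>+\<^sup>1 - x\<^sup>k\<close> tend to zero, and the closed graphs of the proximal mappings and of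
  the limiting subdifferential of \<open>p\<close>, together with local boundedness of the latter, yield the
  fixed-point relation in the limit.
\<close>

section \<open>Bregman distances of smooth functions\<close>

text \<open>\<open>gradient\<close> is a definite description, so uniqueness comes first: two
  gradients at a point induce the same linear functional and hence coincide.\<close>

lemma L_smooth_GDERIV:
  assumes "L_smooth L f"
  shows "GDERIV f x :> gradient f x"
proof -
  obtain D where D: "GDERIV f x :> D"
    using assms by (auto simp: L_smooth_def)
  have "D' = D" if "GDERIV f x :> D'" for D'
  proof -
    have "(\<lambda>h. inner h D') = (\<lambda>h. inner h D)"
      using that D unfolding gderiv_def by (rule has_derivative_unique)
    then show ?thesis
      by (metis inner_commute vector_eq_rdot)
  qed
  then show ?thesis
    unfolding gradient_def using D by (metis theI)
qed

lemma L_smooth_lipschitz: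
  assumes "L_smooth L f"
  shows "L-lipschitz_on UNIV (gradient f)"
  using assms by (simp add: L_smooth_def)

lemma L_smooth_nonneg:
  assumes "L_smooth L f"
  shows "0 \<le> L"
  using L_smooth_lipschitz[OF assms] by (rule lipschitz_on_nonneg)

lemma L_smooth_continuous:
  assumes "L_smooth L f"
  shows "continuous_on UNIV f"
  using L_smooth_GDERIV[OF assms] has_derivative_continuous
  unfolding gderiv_def continuous_on_eq_continuous_at[OF open_UNIV] by blast

lemma GDERIV_line:
  fixes F :: "'a::real_inner \<Rightarrow> real"
  assumes "GDERIV F (x + t *\<^sub>R d) :> G"
  shows "((\<lambda>s. F (x + s *\<^sub>R d)) has_real_derivative G \<bullet> d) (at t)"
proof -
  have "((\<lambda>s. x + s *\<^sub>R d) has_derivative (\<lambda>s. s *\<^sub>R d)) (at t)"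
    by (auto intro!: derivative_eq_intros)
  then have "((\<lambda>s. F (x + s *\<^sub>R d)) has_derivative (\<lambda>s. (s *\<^sub>R d) \<bullet> G)) (at t)"
    by (rule has_derivative_compose) (use assms in \<open>simp add: gderiv_def\<close>)
  then show ?thesis
    by (simp add: has_field_derivative_def inner_commute[of G] mult.commute[of _ "d \<bullet> G"])
qed

lemma GDERIV_half_norm_squared:
  fixes x :: "'a::real_inner"
  shows "GDERIV (\<lambda>x. s / 2 * (norm x)\<^sup>2) x :> s *\<^sub>R x"
  unfolding gderiv_def power2_norm_eq_inner
  by (auto intro!: derivative_eq_intros ext simp: inner_commute)

text \<open>The linearisation is taken at the second point. The field \<open>G\<close> is a separate
  argument so that a shift of \<open>F\<close> by \<open>s / 2 * (norm x)\<^sup>2\<close> can be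
  matched by the shift \<open>s *\<^sub>R x\<close> of \<open>G\<close>.\<close>

definition bregman :: "('a::real_inner \<Rightarrow> real) \<Rightarrow> ('a \<Rightarrow> 'a) \<Rightarrow> 'a \<Rightarrow> 'a \<Rightarrow> real" where
  "bregman F G x y = F x - F y - G y \<bullet> (x - y)"

lemma bregman_symmetrized:
  "bregman F G x y + bregman F G y x = (G x - G y) \<bullet> (x - y)"
  by (simp add: bregman_def algebra_simps)

lemma bregman_add_half_norm_squared:
  "bregman (\<lambda>x. F x + s / 2 * (norm x)\<^sup>2) (\<lambda>x. G x + s *\<^sub>R x) x y
     = bregman F G x y + s / 2 * (norm (x - y))\<^sup>2"
  unfolding bregman_def power2_norm_eq_inner
  by (simp add: algebra_simps inner_commute)

text \<open>The descent lemma: along the segment from \<open>x\<close> to \<open>y\<close>,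
  \<open>F\<close> minus its quadratic upper model is nonincreasing, because Cauchy-Schwarz and the
  Lipschitz condition control the derivative.\<close>

lemma bregman_le_lipschitz_gradient:
  fixes F :: "'a::real_inner \<Rightarrow> real"
  assumes deriv: "\<And>x. GDERIV F x :> G x" and lip: "M-lipschitz_on UNIV G"
  shows "bregman F G y x \<le> M / 2 * (norm (y - x))\<^sup>2"
proof -
  define d where "d = y - x"
  define \<psi> where "\<psi> t = F (x + t *\<^sub>R d) - t * (G x \<bullet> d) - M / 2 * (norm d)\<^sup>2 * t\<^sup>2" for t
  have "\<psi> 1 \<le> \<psi> 0"
  proof (rule DERIV_nonpos_imp_nonincreasing[of 0 1 \<psi>])
    fix t :: real
    assume t: "0 \<le> t" "t \<le> 1"
    let ?D = "(G (x + t *\<^sub>R d) - G x) \<bullet> d - M * (norm d)\<^sup>2 * t"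
    have "(\<psi> has_real_derivative ?D) (at t)"
      unfolding \<psi>_def
      by (auto intro!: derivative_eq_intros GDERIV_line deriv simp: inner_diff_left)
    moreover have "norm (G (x + t *\<^sub>R d) - G x) \<le> M * (t * norm d)"
      using lipschitz_onD[OF lip UNIV_I UNIV_I, of "x + t *\<^sub>R d" x] t
      by (simp add: dist_norm)
    then have "(G (x + t *\<^sub>R d) - G x) \<bullet> d \<le> M * (t * norm d) * norm d"
      by (meson norm_cauchy_schwarz mult_right_mono norm_ge_zero order_trans)
    then have "?D \<le> 0"
      by (simp add: power2_eq_square mult_ac)
    ultimately show "\<exists>y. DERIV \<psi> t :> y \<and> y \<le> 0"
      by blast
  qed simp
  then show ?thesis
    by (simp add: \<psi>_def d_def bregman_def algebra_simps)
qed

lemma convex_bregman_nonneg: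
  fixes F :: "'a::real_inner \<Rightarrow> real"
  assumes "convex_on UNIV F" and "GDERIV F x :> G x"
  shows "0 \<le> bregman F G y x"
proof -
  let ?\<phi> = "\<lambda>t. F (x + t *\<^sub>R (y - x))"
  have "convex_on UNIV ?\<phi>"
  proof (rule convex_onI)
    fix t a b :: real
    assume "0 < t" "t < 1"
    then have "F ((1 - t) *\<^sub>R (x + a *\<^sub>R (y - x)) + t *\<^sub>R (x + b *\<^sub>R (y - x)))
        \<le> (1 - t) * ?\<phi> a + t * ?\<phi> b"
      by (intro convex_onD[OF assms(1)]) auto
    then show "?\<phi> ((1 - t) *\<^sub>R a + t *\<^sub>R b) \<le> (1 - t) * ?\<phi> a + t * ?\<phi> b"
      by (simp add: algebra_simps)
  qed simp
  moreover have "(?\<phi> has_real_derivative G x \<bullet> (y - x)) (at 0)"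
    using GDERIV_line[of F x 0 "y - x" "G x"] assms(2) by simp
  ultimately have "?\<phi> 1 - ?\<phi> 0 \<ge> G x \<bullet> (y - x) * (1 - 0)"
    by (intro convex_on_imp_above_tangent[of UNIV]) auto
  then show ?thesis
    by (simp add: bregman_def)
qed

text \<open>This is the tangent inequality for the shifted convex function. The sign of
  \<open>s\<close> is free; a negative \<open>s\<close> expresses strong convexity.\<close>

lemma bregman_ge_weak_convexity:
  fixes F :: "'a::real_inner \<Rightarrow> real"
  assumes "convex_on UNIV (\<lambda>x. F x + s / 2 * (norm x)\<^sup>2)" and "\<And>x. GDERIV F x :> G x"
  shows "- s / 2 * (norm (y - x))\<^sup>2 \<le> bregman F G y x"
proof -
  have "GDERIV (\<lambda>x. F x + s / 2 * (norm x)\<^sup>2) x :> (\<lambda>x. G x + s *\<^sub>R x) x"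
    by (intro GDERIV_add GDERIV_half_norm_squared assms(2))
  from convex_bregman_nonneg[OF assms(1), of x "\<lambda>x. G x + s *\<^sub>R x" y, OF this] show ?thesis
    unfolding bregman_add_half_norm_squared by simp
qed

text \<open>The function \<open>u \<mapsto> bregman F G u y\<close> has its minimum \<open>0\<close> at \<open>y\<close>; evaluate it
  after a gradient step of length \<open>1 / M\<close> from \<open>x\<close>.\<close>

lemma bregman_cocoercive:
  fixes F :: "'a::real_inner \<Rightarrow> real"
  assumes conv: "convex_on UNIV F"
    and deriv: "\<And>x. GDERIV F x :> G x" and lip: "M-lipschitz_on UNIV G"
  shows "(norm (G x - G y))\<^sup>2 \<le> 2 * M * bregman F G x y"
proof (cases "M = 0")
  case True
  then show ?thesis
    using lipschitz_onD[OF lip UNIV_I UNIV_I, of x y] by (simp add: dist_norm)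
next
  case False
  then have M: "M > 0"
    using lipschitz_on_nonneg[OF lip] by simp
  define v where "v = G x - G y"
  define u where "u = x - (1 / M) *\<^sub>R v"
  have "0 \<le> bregman F G u y"
    using conv deriv by (rule convex_bregman_nonneg)
  also have "bregman F G u y = bregman F G u x + bregman F G x y + v \<bullet> (u - x)"
    by (simp add: bregman_def v_def algebra_simps)
  also have "bregman F G u x \<le> M / 2 * (norm (u - x))\<^sup>2"
    by (rule bregman_le_lipschitz_gradient[OF deriv lip])
  also have "(norm (u - x))\<^sup>2 = (norm v)\<^sup>2 / M\<^sup>2"
    using M by (simp add: u_def power_divide)
  also have "v \<bullet> (u - x) = - (norm v)\<^sup>2 / M"
    by (simp add: u_def power2_norm_eq_inner)
  finally show ?thesis
    using M by (simp add: v_def field_simps power2_eq_square)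
qed

lemma lipschitz_on_norm_le:
  fixes F :: "'a::real_inner \<Rightarrow> real"
  assumes "M-lipschitz_on UNIV G"
  shows "norm (G x - G y) \<le> M * norm (x - y)"
  using lipschitz_onD[OF assms UNIV_I UNIV_I, of x y] by (simp add: dist_norm)

section \<open>Admissible step sizes\<close>

text \<open>Writing \<open>q\<close> for the quadratic, \<open>q r = 0\<close> gives
  \<open>r * q s = (s - r) * (a * s * r + k)\<close> with a positive second factor. This covers
  \<open>a = 0\<close> as well.\<close>

lemma quadratic_sign_at_positive_root:
  fixes a b k r s :: real
  assumes "0 \<le> a" "0 < k" "0 < r" "0 < s" and root: "a * r\<^sup>2 + b * r - k = 0"
  shows "s < r \<Longrightarrow> a * s\<^sup>2 + b * s - k < 0" and "r < s \<Longrightarrow> a * s\<^sup>2 + b * s - k > 0"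
proof -
  have pos: "0 < a * s * r + k"
    using assms by (simp add: add_nonneg_pos)
  have "r * (a * s\<^sup>2 + b * s - k) = (s - r) * (a * s * r + k) + s * (a * r\<^sup>2 + b * r - k)"
    by algebra
  then have eq: "r * (a * s\<^sup>2 + b * s - k) = (s - r) * (a * s * r + k)"
    by (simp add: root)
  show "a * s\<^sup>2 + b * s - k < 0" if "s < r"
    using eq mult_neg_pos[of "s - r", OF _ pos] that \<open>0 < r\<close>
    by (metis diff_less_0_iff_less less_asym mult_less_0_iff)
  show "a * s\<^sup>2 + b * s - k > 0" if "r < s"
    using eq mult_pos_pos[of "s - r", OF _ pos] that \<open>0 < r\<close>
    by (metis diff_gt_0_iff_gt less_asym zero_less_mult_iff)
qed

text \<open>Up to the factor \<open>2 * \<alpha> * \<tau>\<close>, these are the coefficients of \<open>\<parallel>x\<^sup>k\<^sup>+\<^sup>1 - x\<^sup>k\<parallel>\<^sup>2\<close> in the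
  change of the merit function, negative for a decrease; \<open>H\<close> stands for the contribution of \<open>h\<close>.
  They agree at \<open>\<alpha> = \<tau> / (2 * (Lf - \<rho>))\<close>, where the dominant bound on the contribution
  of \<open>f\<close> changes.\<close>

definition rate_smooth :: "real \<Rightarrow> real \<Rightarrow> real \<Rightarrow> real \<Rightarrow> real \<Rightarrow> real" where
  "rate_smooth Lf Lh \<tau> H \<alpha> = 2 * Lf * (Lf + Lh) * \<alpha>\<^sup>2 + (H - \<tau> * Lf) * \<alpha> - (2 - \<tau>)"

definition rate_weak :: "real \<Rightarrow> real \<Rightarrow> real \<Rightarrow> real \<Rightarrow> real \<Rightarrow> real \<Rightarrow> real" where
  "rate_weak Lf Lh \<rho> \<tau> H \<alpha> = 2 * (\<rho>\<^sup>2 + Lf * Lh) * \<alpha>\<^sup>2 + (H + \<rho> * \<tau>) * \<alpha> - (2 - \<tau>)"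

lemma rate_weak_minus_smooth:
  "rate_weak Lf Lh \<rho> \<tau> H \<alpha> - rate_smooth Lf Lh \<tau> H \<alpha>
     = \<alpha> * (Lf + \<rho>) * (\<tau> - 2 * \<alpha> * (Lf - \<rho>))"
  unfolding rate_weak_def rate_smooth_def by algebra

text \<open>The two rates agree at the crossover step size \<open>\<alpha>0\<close>, so a sign found
  there for one of them transfers to the other. Hence the prescribed threshold is the root of
  whichever rate is relevant near it.\<close>

lemma rate_negative_below_threshold:
  assumes nonneg: "0 \<le> Lf" "0 \<le> Lh" "0 \<le> \<rho>" "\<rho> \<le> Lf"
    and \<tau>: "0 < \<tau>" "\<tau> < 2"
    and \<alpha>1: "0 < \<alpha>1" "rate_smooth Lf Lh \<tau> H \<alpha>1 = 0"
    and \<alpha>: "0 < \<alpha>" "\<alpha> < \<alpha>bar"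
    and \<alpha>bar: "if \<tau> \<le> 2 * \<alpha>1 * (Lf - \<rho>) then \<alpha>bar = \<alpha>1
      else rate_weak Lf Lh \<rho> \<tau> H \<alpha>bar = 0"
  shows "(\<tau> \<le> 2 * \<alpha> * (Lf - \<rho>) \<and> rate_smooth Lf Lh \<tau> H \<alpha> < 0) \<or>
    (2 * \<alpha> * (Lf - \<rho>) \<le> \<tau> \<and> rate_weak Lf Lh \<rho> \<tau> H \<alpha> < 0)"
proof -
  let ?S = "rate_smooth Lf Lh \<tau> H" and ?W = "rate_weak Lf Lh \<rho> \<tau> H"
  have aS: "0 \<le> 2 * Lf * (Lf + Lh)" and aW: "0 \<le> 2 * (\<rho>\<^sup>2 + Lf * Lh)" and k: "0 < 2 - \<tau>"
    using nonneg \<tau> by auto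
  note S = quadratic_sign_at_positive_root[OF aS k \<alpha>1(1) _ \<alpha>1(2)[unfolded rate_smooth_def],
      folded rate_smooth_def]
  define \<alpha>0 where "\<alpha>0 = \<tau> / (2 * (Lf - \<rho>))"
  have \<alpha>0: "0 < \<alpha>0" "2 * \<alpha>0 * (Lf - \<rho>) = \<tau>" "?W \<alpha>0 = ?S \<alpha>0" if "\<rho> < Lf"
  proof -
    show "0 < \<alpha>0"
      using that \<tau> by (simp add: \<alpha>0_def)
    have "2 * (\<tau> / (2 * c)) * c = \<tau>" if "c \<noteq> 0" for c
      using that by simp
    from this[of "Lf - \<rho>"] show "2 * \<alpha>0 * (Lf - \<rho>) = \<tau>"
      using that by (simp only: \<alpha>0_def)
    then show "?W \<alpha>0 = ?S \<alpha>0"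
      using rate_weak_minus_smooth[of Lf Lh \<rho> \<tau> H \<alpha>0] by simp
  qed
  have less_iff: "s < \<alpha>0 \<longleftrightarrow> 2 * s * (Lf - \<rho>) < \<tau>" if "\<rho> < Lf" for s
    using that by (simp add: \<alpha>0_def field_simps)
  show ?thesis
  proof (cases "\<tau> \<le> 2 * \<alpha>1 * (Lf - \<rho>)")
    case True
    then have \<rho>: "\<rho> < Lf"
      using \<tau> nonneg by (cases "\<rho> = Lf") auto
    have \<alpha>1_ge: "\<alpha>0 \<le> \<alpha>1"
      using True less_iff[OF \<rho>, of \<alpha>1] by linarith
    have "\<alpha> < \<alpha>1"
      using True \<alpha>bar \<alpha> by simp
    then have neg: "?S \<alpha> < 0"
      using S(1)[OF \<alpha>(1)] by simp
    show ?thesis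
    proof (cases "\<alpha> < \<alpha>0")
      case \<alpha>_less: True
      have "?S \<alpha>0 \<le> 0"
        using S(1)[OF \<alpha>0(1)[OF \<rho>]] \<alpha>1_ge \<alpha>1(2) by (cases "\<alpha>0 = \<alpha>1") auto
      then have "?W \<alpha>0 \<le> 0"
        using \<alpha>0(3)[OF \<rho>] by simp
      \<comment> \<open>\<open>\<alpha>0\<close> need not be a root of the weak rate, so
        \<open>quadratic_sign_at_positive_root\<close> does not apply directly; the identity behind
        it is used with the extra nonpositive term \<open>\<alpha> * ?W \<alpha>0\<close>.\<close>
      have "\<alpha>0 * ?W \<alpha> = \<alpha> * ?W \<alpha>0 + (\<alpha> - \<alpha>0) * (2 * (\<rho>\<^sup>2 + Lf * Lh) * \<alpha> * \<alpha>0 + (2 - \<tau>))"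
        unfolding rate_weak_def by algebra
      moreover have "\<alpha> * ?W \<alpha>0 \<le> 0"
        using \<open>?W \<alpha>0 \<le> 0\<close> \<alpha>(1) by (simp add: mult_le_0_iff)
      moreover have "(\<alpha> - \<alpha>0) * (2 * (\<rho>\<^sup>2 + Lf * Lh) * \<alpha> * \<alpha>0 + (2 - \<tau>)) < 0"
        using \<alpha>_less aW k \<alpha>(1) \<alpha>0(1)[OF \<rho>] by (intro mult_neg_pos add_nonneg_pos) auto
      ultimately have "\<alpha>0 * ?W \<alpha> < 0"
        by linarith
      then have "?W \<alpha> < 0"
        using \<alpha>0(1)[OF \<rho>] by (simp add: mult_less_0_iff)
      then show ?thesis
        using \<alpha>_less less_iff[OF \<rho>, of \<alpha>] by auto
    next
      case False
      then show ?thesis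
        using neg less_iff[OF \<rho>, of \<alpha>] by auto
    qed
  next
    case False
    then have root: "?W \<alpha>bar = 0" and "0 < \<alpha>bar"
      using \<alpha>bar \<alpha> by auto
    note W = quadratic_sign_at_positive_root[OF aW k \<open>0 < \<alpha>bar\<close> _ root[unfolded rate_weak_def],
      folded rate_weak_def]
    have neg: "?W \<alpha> < 0"
      using W(1)[OF \<alpha>(1)] \<alpha>(2) by simp
    \<comment> \<open>Otherwise \<open>\<alpha>1 < \<alpha>0 < \<alpha>bar\<close>, so at
      \<open>\<alpha>0\<close> the smooth rate would be positive and the weak rate negative,
      although they agree there.\<close>
    have "2 * \<alpha> * (Lf - \<rho>) \<le> \<tau>"
    proof (rule ccontr)
      assume *: "\<not> 2 * \<alpha> * (Lf - \<rho>) \<le> \<tau>"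
      then have \<rho>: "\<rho> < Lf"
        using \<tau> nonneg by (cases "\<rho> = Lf") auto
      have "\<alpha>1 < \<alpha>0"
        using False less_iff[OF \<rho>] by auto
      then have "0 < ?S \<alpha>0"
        using S(2)[OF \<alpha>0(1)[OF \<rho>]] by simp
      moreover have "\<alpha>0 < \<alpha>bar"
        using * less_iff[OF \<rho>, of \<alpha>] \<alpha>(2) by auto
      then have "?W \<alpha>0 < 0"
        using W(1)[OF \<alpha>0(1)[OF \<rho>]] by simp
      ultimately show False
        using \<alpha>0(3)[OF \<rho>] by simp
    qed
    then show ?thesis
      using neg by simp
  qed
qed

text \<open>Under the substitution \<open>\<alpha> = \<tau> / (2 * \<eta>)\<close> the polynomial in
  \<open>\<eta>\<close> is \<open>- 2 * \<eta>\<^sup>2\<close> times the weak rate, so the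
  definition of admissibility prescribes a root of that rate.\<close>

lemma rate_weak_root_reciprocal:
  assumes "0 < \<eta>" "0 < \<tau>"
    and "quadratic_root (2 * (2 - \<tau>)) (- (\<tau> * (H + \<rho> * \<tau>))) (- (\<tau>\<^sup>2 * (\<rho>\<^sup>2 + Lf * Lh))) \<eta>"
  shows "rate_weak Lf Lh \<rho> \<tau> H (\<tau> / (2 * \<eta>)) = 0"
proof -
  have "- 2 * \<eta>\<^sup>2 * rate_weak Lf Lh \<rho> \<tau> H (\<tau> / (2 * \<eta>))
     = 2 * (2 - \<tau>) * \<eta>\<^sup>2 + (- (\<tau> * (H + \<rho> * \<tau>))) * \<eta> + (- (\<tau>\<^sup>2 * (\<rho>\<^sup>2 + Lf * Lh)))"
    unfolding rate_weak_def using assms(1)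
    by (simp add: field_simps power2_eq_square)
  also have "\<dots> = 0"
    using assms(3) unfolding quadratic_root_def .
  finally show ?thesis
    using assms(1) by simp
qed

text \<open>For \<open>H = (2 - \<tau>) * Lh\<close> the smooth rate has the explicit root
  \<open>1 / (Lf + Lh)\<close>, and the case distinction in the definition is the general threshold
  criterion at that root.\<close>

lemma admissible_A_rate_negative:
  assumes "0 \<le> Lf" "0 \<le> Lh" "0 < Lf + Lh" "0 \<le> \<rho>" "\<rho> \<le> Lf"
    and adm: "admissible_A Lf Lh \<rho> \<tau> \<alpha>"
  shows "(\<tau> \<le> 2 * \<alpha> * (Lf - \<rho>) \<and> rate_smooth Lf Lh \<tau> ((2 - \<tau>) * Lh) \<alpha> < 0) \<or>
    (2 * \<alpha> * (Lf - \<rho>) \<le> \<tau> \<and> rate_weak Lf Lh \<rho> \<tau> ((2 - \<tau>) * Lh) \<alpha> < 0)"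
proof -
  obtain \<alpha>bar where \<tau>: "0 < \<tau>" "\<tau> \<le> 1" and \<alpha>: "0 < \<alpha>" "\<alpha> < \<alpha>bar"
    and \<alpha>bar: "if (2 - \<tau>) * Lf - 2 * \<rho> \<ge> \<tau> * Lh then \<alpha>bar = 1 / (Lf + Lh)
      else \<exists>\<eta>. positive_root (2 * (2 - \<tau>)) (- (\<tau> * ((2 - \<tau>) * Lh + \<rho> * \<tau>)))
        (- (\<tau>\<^sup>2 * (\<rho>\<^sup>2 + Lf * Lh))) \<eta> \<and> \<alpha>bar = \<tau> / (2 * \<eta>)"
    using adm unfolding admissible_A_def by blast
  have S: "Lf + Lh \<noteq> 0" "0 < Lf + Lh"
    using assms by auto
  have "rate_smooth Lf Lh \<tau> ((2 - \<tau>) * Lh) (1 / (Lf + Lh))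
      = (2 * Lf + ((2 - \<tau>) * Lh - \<tau> * Lf)) / (Lf + Lh) - (2 - \<tau>)"
    unfolding rate_smooth_def using S(1) by (simp add: add_divide_distrib power2_eq_square)
  also have "2 * Lf + ((2 - \<tau>) * Lh - \<tau> * Lf) = (2 - \<tau>) * (Lf + Lh)"
    by algebra
  finally have root: "rate_smooth Lf Lh \<tau> ((2 - \<tau>) * Lh) (1 / (Lf + Lh)) = 0"
    using S by simp
  have cond: "\<tau> \<le> 2 * (1 / (Lf + Lh)) * (Lf - \<rho>) \<longleftrightarrow> (2 - \<tau>) * Lf - 2 * \<rho> \<ge> \<tau> * Lh"
    using S by (simp add: field_simps)
  show ?thesis
  proof (rule rate_negative_below_threshold[OF assms(1,2,4,5) \<tau>(1) _ _ root \<alpha>])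
    show "if \<tau> \<le> 2 * (1 / (Lf + Lh)) * (Lf - \<rho>) then \<alpha>bar = 1 / (Lf + Lh)
      else rate_weak Lf Lh \<rho> \<tau> ((2 - \<tau>) * Lh) \<alpha>bar = 0"
      unfolding cond using \<alpha>bar \<tau>(1)
      by (auto simp: positive_root_def intro!: rate_weak_root_reciprocal)
  qed (use S \<tau> in auto)
qed

lemma admissible_B_rate_negative:
  assumes "0 \<le> Lf" "0 \<le> Lh" "0 \<le> \<rho>" "\<rho> \<le> Lf"
    and adm: "admissible_B h Lf Lh \<rho> \<tau> \<alpha>"
  obtains \<sigma> where "convex_on UNIV (\<lambda>x. h x - \<sigma> / 2 * (norm x)\<^sup>2)"
    and "(\<tau> \<le> 2 * \<alpha> * (Lf - \<rho>) \<and> rate_smooth Lf Lh \<tau> (\<tau> * Lh - 2 * (\<tau> - 1) * \<sigma>) \<alpha> < 0) \<or>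
    (2 * \<alpha> * (Lf - \<rho>) \<le> \<tau> \<and> rate_weak Lf Lh \<rho> \<tau> (\<tau> * Lh - 2 * (\<tau> - 1) * \<sigma>) \<alpha> < 0)"
proof -
  obtain \<sigma> \<alpha>1 \<alpha>bar where \<tau>: "1 < \<tau>" "\<tau> < 2" and \<alpha>: "0 < \<alpha>" "\<alpha> < \<alpha>bar"
    and conv: "convex_on UNIV (\<lambda>x. h x - \<sigma> / 2 * (norm x)\<^sup>2)"
    and \<alpha>1: "positive_root (2 * Lf * (Lf + Lh)) (\<tau> * Lh - 2 * (\<tau> - 1) * \<sigma> - \<tau> * Lf)
          (- (2 - \<tau>)) \<alpha>1"
    and \<alpha>bar: "if \<tau> \<le> 2 * \<alpha>1 * (Lf - \<rho>) then \<alpha>bar = \<alpha>1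
      else \<exists>\<eta>. positive_root (2 * (2 - \<tau>)) (- (\<tau> * (\<tau> * Lh - 2 * (\<tau> - 1) * \<sigma> + \<rho> * \<tau>)))
        (- (\<tau>\<^sup>2 * (\<rho>\<^sup>2 + Lf * Lh))) \<eta> \<and> \<alpha>bar = \<tau> / (2 * \<eta>)"
    using adm unfolding admissible_B_def by blast
  have \<alpha>1': "0 < \<alpha>1" "rate_smooth Lf Lh \<tau> (\<tau> * Lh - 2 * (\<tau> - 1) * \<sigma>) \<alpha>1 = 0"
    using \<alpha>1 by (auto simp: positive_root_def quadratic_root_def rate_smooth_def)
  show thesis
  proof (rule that[OF conv], rule rate_negative_below_threshold[OF assms(1-4) _ \<tau>(2) \<alpha>1' \<alpha>])
    show "if \<tau> \<le> 2 * \<alpha>1 * (Lf - \<rho>) then \<alpha>bar = \<alpha>1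
      else rate_weak Lf Lh \<rho> \<tau> (\<tau> * Lh - 2 * (\<tau> - 1) * \<sigma>) \<alpha>bar = 0"
      using \<alpha>bar \<tau>(1)
      by (auto simp: positive_root_def intro!: rate_weak_root_reciprocal)
  qed (use \<tau> in auto)
qed

lemma quadratic_negative_between_roots:
  fixes a b c :: real
  assumes "0 < a" "quadratic_root a b c r" "quadratic_root a b c s" "r < t" "t < s"
  shows "a * t\<^sup>2 + b * t + c < 0"
proof -
  have "a * r\<^sup>2 + b * r + c = 0" "a * s\<^sup>2 + b * s + c = 0"
    using assms by (auto simp: quadratic_root_def)
  then have "(s - r) * (a * t\<^sup>2 + b * t + c) = (s - r) * (a * (t - r) * (t - s))"
    by algebra
  then have "a * t\<^sup>2 + b * t + c = a * (t - r) * (t - s)"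
    using assms by simp
  also have "\<dots> < 0"
    using assms by (intro mult_pos_neg) auto
  finally show ?thesis .
qed

lemma admissible_C_rate_negative:
  assumes "0 \<le> Lf" "0 \<le> Lh"
    and \<sigma>_le: "\<And>\<sigma>. convex_on UNIV (\<lambda>x. f x - \<sigma> / 2 * (norm x)\<^sup>2) \<Longrightarrow> \<sigma> \<le> Lf"
    and adm: "admissible_C f h Lf Lh \<tau> \<alpha>"
  obtains \<sigma> \<rho>h where "0 < \<sigma>" "\<sigma> \<le> Lf" "convex_on UNIV (\<lambda>x. f x - \<sigma> / 2 * (norm x)\<^sup>2)"
    and "convex_on UNIV (\<lambda>x. h x + \<rho>h / 2 * (norm x)\<^sup>2)"
    and "2 \<le> \<tau>" "0 < \<alpha>" "2 * (\<alpha> / \<tau>) * Lf \<le> 1"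
    and "2 * (\<sigma> * Lf + Lf * Lh) * \<alpha>\<^sup>2 + (\<tau> * Lh + 2 * (\<tau> - 1) * \<rho>h - \<sigma> * \<tau>) * \<alpha> - (2 - \<tau>) < 0"
proof -
  define S where "S = Lf + Lh"
  obtain \<sigma> \<rho>h \<mu>1 \<mu>2 where sc: "strongly_convex \<sigma> f" and wc: "weakly_convex \<rho>h h" and \<tau>: "2 \<le> \<tau>"
    and roots: "\<forall>\<mu>\<in>{\<mu>1, \<mu>2}. quadratic_root
        (\<tau>\<^sup>2 * (Lh * (Lf\<^sup>2 - \<sigma>\<^sup>2) / (Lf * S\<^sup>2) + \<sigma> / S))
        (- (\<tau>\<^sup>2 * (\<sigma> / S - Lh / S - 2 * (\<tau> - 1) / \<tau> * (\<rho>h / S)))) (2 * (\<tau> - 2)) \<mu>"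
    and \<alpha>: "\<tau> * \<mu>1 / (2 * S) < \<alpha>" "\<alpha> < \<tau> * \<mu>2 / (2 * S)" "0 < \<alpha>" "\<alpha> < 1 / S"
    using adm unfolding admissible_C_def Let_def S_def by auto
  have \<sigma>: "0 < \<sigma>" and conv: "convex_on UNIV (\<lambda>x. f x - \<sigma> / 2 * (norm x)\<^sup>2)"
    using sc by (auto simp: strongly_convex_def)
  then have "\<sigma> \<le> Lf"
    using \<sigma>_le by blast
  then have Lf: "0 < Lf" and S: "0 < S" "Lf \<le> S"
    using \<sigma> assms by (auto simp: S_def)
  have sq: "0 \<le> Lf\<^sup>2 - \<sigma>\<^sup>2"
    using \<open>\<sigma> \<le> Lf\<close> \<sigma> by (simp add: power_mono)
  \<comment> \<open>This inverts the scaling in the definition: the prescribed interval for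
    \<open>\<alpha>\<close> says that \<open>\<mu>\<close> lies strictly between the two
    roots.\<close>
  define \<mu> where "\<mu> = 2 * S * \<alpha> / \<tau>"
  have \<mu>: "\<mu>1 < \<mu>" "\<mu> < \<mu>2"
    using \<alpha> S \<tau> by (auto simp: \<mu>_def field_simps)
  have "0 < \<tau>\<^sup>2 * (Lh * (Lf\<^sup>2 - \<sigma>\<^sup>2) / (Lf * S\<^sup>2) + \<sigma> / S)"
    using \<tau> assms sq Lf S \<sigma> by (intro mult_pos_pos add_nonneg_pos) auto
  with \<mu> roots have "\<tau>\<^sup>2 * (Lh * (Lf\<^sup>2 - \<sigma>\<^sup>2) / (Lf * S\<^sup>2) + \<sigma> / S) * \<mu>\<^sup>2
      + (- (\<tau>\<^sup>2 * (\<sigma> / S - Lh / S - 2 * (\<tau> - 1) / \<tau> * (\<rho>h / S)))) * \<mu> + 2 * (\<tau> - 2) < 0"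
    by (intro quadratic_negative_between_roots[where r = \<mu>1 and s = \<mu>2]) auto
  also have "\<tau>\<^sup>2 * (Lh * (Lf\<^sup>2 - \<sigma>\<^sup>2) / (Lf * S\<^sup>2) + \<sigma> / S) * \<mu>\<^sup>2
      = 4 * \<alpha>\<^sup>2 * (Lh * (Lf\<^sup>2 - \<sigma>\<^sup>2) / Lf + \<sigma> * S)"
    using \<tau> Lf S by (simp add: \<mu>_def field_simps power2_eq_square)
  also have "(- (\<tau>\<^sup>2 * (\<sigma> / S - Lh / S - 2 * (\<tau> - 1) / \<tau> * (\<rho>h / S)))) * \<mu>
      = - 2 * \<alpha> * (\<tau> * \<sigma> - \<tau> * Lh - 2 * (\<tau> - 1) * \<rho>h)"
    using \<tau> S by (simp add: \<mu>_def field_simps power2_eq_square)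
  finally have main: "4 * \<alpha>\<^sup>2 * (Lh * (Lf\<^sup>2 - \<sigma>\<^sup>2) / Lf + \<sigma> * S)
      + - 2 * \<alpha> * (\<tau> * \<sigma> - \<tau> * Lh - 2 * (\<tau> - 1) * \<rho>h) + 2 * (\<tau> - 2) < 0" .
  \<comment> \<open>The leading coefficient from the definition exceeds the one wanted for the
    decrease by \<open>Lh * \<sigma> * (Lf - \<sigma>) / Lf\<close>, which is nonnegative because
    \<open>\<sigma> \<le> Lf\<close>.\<close>
  have "Lh * (Lf\<^sup>2 - \<sigma>\<^sup>2) / Lf + \<sigma> * S = \<sigma> * Lf + Lf * Lh + Lh * \<sigma> * (Lf - \<sigma>) / Lf"
    using Lf by (simp add: S_def field_simps power2_eq_square)
  also have "\<dots> \<ge> \<sigma> * Lf + Lf * Lh"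
    using Lf \<sigma> assms \<open>\<sigma> \<le> Lf\<close> by simp
  finally have "4 * \<alpha>\<^sup>2 * (\<sigma> * Lf + Lf * Lh) \<le> 4 * \<alpha>\<^sup>2 * (Lh * (Lf\<^sup>2 - \<sigma>\<^sup>2) / Lf + \<sigma> * S)"
    by (intro mult_left_mono) auto
  with main have rate:
    "2 * (\<sigma> * Lf + Lf * Lh) * \<alpha>\<^sup>2 + (\<tau> * Lh + 2 * (\<tau> - 1) * \<rho>h - \<sigma> * \<tau>) * \<alpha> - (2 - \<tau>) < 0"
    by (simp add: algebra_simps)
  \<comment> \<open>From \<open>\<alpha> < 1 / S\<close> and \<open>2 \<le> \<tau>\<close> comes the
    smallness condition of \<open>strongly_convex_gradient_difference_bound\<close> for
    \<open>c = \<alpha> / \<tau>\<close>.\<close>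
  have "\<alpha> * Lf \<le> \<alpha> * S"
    using S \<alpha> by (intro mult_left_mono) auto
  also have "\<dots> < 1"
    using \<alpha> S by (simp add: field_simps)
  finally have "2 * (\<alpha> / \<tau>) * Lf \<le> 1"
    using \<tau> by (simp add: field_simps)
  then show thesis
    using that[OF \<sigma> \<open>\<sigma> \<le> Lf\<close> conv _ \<tau> \<alpha>(3) _ rate] wc by (simp add: weakly_convex_def)
qed

section \<open>Decrease of the smooth model\<close>

text \<open>After the shift by \<open>\<rho> / 2 * (norm x)\<^sup>2\<close> the function is convex
  and cocoercivity gives \<open>q \<le> 2 * D1\<close> and \<open>q \<le> 2 * D2\<close>. What
  remains is \<open>(c * (L - \<rho>) - 1 / 2) * q\<close>; the sign of its coefficient decides
  whether \<open>0 \<le> q\<close> or \<open>q \<le> M * (norm d)\<^sup>2\<close> is used.\<close>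

lemma weakly_convex_gradient_difference_bound:
  fixes F :: "'a::real_inner \<Rightarrow> real"
  assumes conv: "convex_on UNIV (\<lambda>x. F x + \<rho> / 2 * (norm x)\<^sup>2)"
    and deriv: "\<And>x. GDERIV F x :> G x" and lip: "L-lipschitz_on UNIV G"
    and "0 \<le> \<rho>" "0 \<le> c"
  shows "2 * c * (L - \<rho>) \<le> 1 \<Longrightarrow>
      c * (norm (G x' - G x))\<^sup>2 - bregman F G x x' \<le> (\<rho> / 2 + c * \<rho>\<^sup>2) * (norm (x' - x))\<^sup>2"
    and "1 \<le> 2 * c * (L - \<rho>) \<Longrightarrow>
      c * (norm (G x' - G x))\<^sup>2 - bregman F G x x' \<le> (c * L\<^sup>2 - L / 2) * (norm (x' - x))\<^sup>2"
proof -
  define d where "d = x' - x"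
  define M where "M = L + \<rho>"
  define F' where "F' = (\<lambda>x. F x + \<rho> / 2 * (norm x)\<^sup>2)"
  define G' where "G' = (\<lambda>x. G x + \<rho> *\<^sub>R x)"
  define v where "v = G' x' - G' x"
  define D1 where "D1 = bregman F' G' x x'"
  define D2 where "D2 = bregman F' G' x' x"
  \<comment> \<open>If \<open>M = 0\<close>, division by zero yields \<open>q = 0\<close>, which is
    consistent because then \<open>v = 0\<close>.\<close>
  define q where "q = (norm v)\<^sup>2 / M"
  have M: "0 \<le> M"
    using lipschitz_on_nonneg[OF lip] \<open>0 \<le> \<rho>\<close> by (simp add: M_def)
  have deriv': "GDERIV F' x :> G' x" for x
    unfolding F'_def G'_def by (intro GDERIV_add GDERIV_half_norm_squared deriv)
  have lip': "M-lipschitz_on UNIV G'"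
    unfolding M_def G'_def
    using lipschitz_on_cmult_nonneg[OF lipschitz_on_id \<open>0 \<le> \<rho>\<close>]
    by (intro lipschitz_on_add lip) simp
  have conv': "convex_on UNIV F'"
    using conv by (simp add: F'_def)
  have D_nonneg: "0 \<le> D1" "0 \<le> D2"
    unfolding D1_def D2_def by (intro convex_bregman_nonneg conv' deriv')+
  have nv: "norm v \<le> M * norm d"
    unfolding v_def d_def by (rule lipschitz_on_norm_le[OF lip'])
  have v_q: "(norm v)\<^sup>2 = M * q"
    using nv by (cases "M = 0") (auto simp: q_def)
  have coc: "M * q \<le> 2 * M * D1" "M * q \<le> 2 * M * D2"
    unfolding v_q[symmetric] unfolding D1_def D2_def v_def
    using bregman_cocoercive[OF conv' deriv' lip', of x x']
      bregman_cocoercive[OF conv' deriv' lip', of x' x]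
    by (simp_all only: norm_minus_commute[of "G' x" "G' x'"])
  have q_D: "q \<le> 2 * D1" "q \<le> 2 * D2"
  proof -
    have "q \<le> 2 * D" if "M * q \<le> 2 * M * D" "0 \<le> D" for D
    proof (cases "M = 0")
      case True
      then show ?thesis
        using that by (simp add: q_def)
    next
      case False
      then show ?thesis
        using that M by (intro mult_left_le_imp_le[of M q "2 * D"]) auto
    qed
    then show "q \<le> 2 * D1" "q \<le> 2 * D2"
      using coc D_nonneg by blast+
  qed
  have "M * q \<le> (M * norm d)\<^sup>2"
    unfolding v_q[symmetric] using nv by (intro power_mono) auto
  then have q_d: "q \<le> M * (norm d)\<^sup>2"
    using M by (cases "M = 0") (auto simp: q_def power2_eq_square pos_divide_le_eq mult_ac)
  have vd: "v \<bullet> d = D1 + D2"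
    unfolding D1_def D2_def v_def d_def using bregman_symmetrized[of F' G' x' x] by simp
  have G_diff: "G x' - G x = v - \<rho> *\<^sub>R d"
    by (simp add: v_def G'_def d_def algebra_simps)
  have sq: "(norm (G x' - G x))\<^sup>2 = M * q - 2 * \<rho> * (D1 + D2) + \<rho>\<^sup>2 * (norm d)\<^sup>2"
    unfolding v_q[symmetric] vd[symmetric] G_diff power2_norm_eq_inner
    by (simp add: inner_diff inner_commute power2_eq_square algebra_simps)
  have breg: "bregman F G x x' = D1 - \<rho> / 2 * (norm d)\<^sup>2"
    unfolding D1_def F'_def G'_def bregman_add_half_norm_squared
    by (simp add: d_def norm_minus_commute)
  have eq: "c * (norm (G x' - G x))\<^sup>2 - bregman F G x x'
      = c * M * q - 2 * c * \<rho> * (D1 + D2) - D1 + (\<rho> / 2 + c * \<rho>\<^sup>2) * (norm d)\<^sup>2"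
    unfolding sq breg by (simp add: algebra_simps)
  have "c * \<rho> * q \<le> c * \<rho> * (D1 + D2)"
    using q_D \<open>0 \<le> c\<close> \<open>0 \<le> \<rho>\<close> by (intro mult_left_mono) auto
  then have le: "c * M * q - 2 * c * \<rho> * (D1 + D2) - D1 \<le> (c * (L - \<rho>) - 1 / 2) * q"
    using q_D by (simp add: M_def algebra_simps)
  have "0 \<le> q"
    using M by (simp add: q_def)
  show "c * (norm (G x' - G x))\<^sup>2 - bregman F G x x' \<le> (\<rho> / 2 + c * \<rho>\<^sup>2) * (norm (x' - x))\<^sup>2"
    if "2 * c * (L - \<rho>) \<le> 1"
  proof -
    have "(c * (L - \<rho>) - 1 / 2) * q \<le> 0"
      using that \<open>0 \<le> q\<close> by (intro mult_nonpos_nonneg) auto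
    then show ?thesis
      using le eq by (simp add: d_def)
  qed
  show "c * (norm (G x' - G x))\<^sup>2 - bregman F G x x' \<le> (c * L\<^sup>2 - L / 2) * (norm (x' - x))\<^sup>2"
    if "1 \<le> 2 * c * (L - \<rho>)"
  proof -
    have "(c * (L - \<rho>) - 1 / 2) * q \<le> (c * (L - \<rho>) - 1 / 2) * (M * (norm d)\<^sup>2)"
      using that q_d by (intro mult_left_mono) auto
    moreover have "(c * (L - \<rho>) - 1 / 2) * (M * (norm d)\<^sup>2) + (\<rho> / 2 + c * \<rho>\<^sup>2) * (norm d)\<^sup>2
        = (c * L\<^sup>2 - L / 2) * (norm d)\<^sup>2"
      unfolding M_def by (simp add: algebra_simps power2_eq_square)
    ultimately show ?thesis
      using le eq by (simp add: d_def)
  qed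
qed

lemma convex_on_norm_squared: "convex_on UNIV (\<lambda>x::'a::real_inner. (norm x)\<^sup>2)"
proof (rule convex_onI)
  fix t :: real and x y :: 'a
  assume "0 < t" "t < 1"
  then have "0 \<le> t * (1 - t) * (norm (x - y))\<^sup>2"
    by simp
  also have "\<dots> = (1 - t) * (norm x)\<^sup>2 + t * (norm y)\<^sup>2 - (norm ((1 - t) *\<^sub>R x + t *\<^sub>R y))\<^sup>2"
    unfolding power2_norm_eq_inner by (simp add: inner_commute algebra_simps)
  finally show "(norm ((1 - t) *\<^sub>R x + t *\<^sub>R y))\<^sup>2 \<le> (1 - t) * (norm x)\<^sup>2 + t * (norm y)\<^sup>2"
    by simp
qed simp

text \<open>With \<open>D = bregman F G x x'\<close>, cocoercivity bounds the left-hand side by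
  \<open>- (1 - 2 * c * L) * D\<close>, and strong convexity bounds \<open>D\<close> from below.\<close>

lemma strongly_convex_gradient_difference_bound:
  fixes F :: "'a::real_inner \<Rightarrow> real"
  assumes conv: "convex_on UNIV (\<lambda>x. F x - \<sigma> / 2 * (norm x)\<^sup>2)"
    and deriv: "\<And>x. GDERIV F x :> G x" and lip: "L-lipschitz_on UNIV G"
    and "0 \<le> \<sigma>" "0 \<le> c" "2 * c * L \<le> 1"
  shows "c * (norm (G x' - G x))\<^sup>2 - bregman F G x x'
    \<le> (c * \<sigma> * L - \<sigma> / 2) * (norm (x' - x))\<^sup>2"
proof -
  have "convex_on UNIV (\<lambda>x::'a. \<sigma> / 2 * (norm x)\<^sup>2)"
    using \<open>0 \<le> \<sigma>\<close> by (intro convex_on_cmul convex_on_norm_squared) simp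
  from convex_on_add[OF conv this] have "convex_on UNIV F"
    by simp
  then have "(norm (G x - G x'))\<^sup>2 \<le> 2 * L * bregman F G x x'"
    using deriv lip by (rule bregman_cocoercive)
  then have "c * (norm (G x' - G x))\<^sup>2 \<le> c * (2 * L * bregman F G x x')"
    using \<open>0 \<le> c\<close> by (intro mult_left_mono) (auto simp: norm_minus_commute)
  moreover have "\<sigma> / 2 * (norm (x - x'))\<^sup>2 \<le> bregman F G x x'"
    using bregman_ge_weak_convexity[of F "- \<sigma>" G x x'] conv deriv by simp
  then have "(1 - 2 * c * L) * (\<sigma> / 2 * (norm (x' - x))\<^sup>2) \<le> (1 - 2 * c * L) * bregman F G x x'"
    using \<open>2 * c * L \<le> 1\<close> by (intro mult_left_mono) (auto simp: norm_minus_commute)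
  ultimately show ?thesis
    by (simp add: algebra_simps diff_divide_distrib)
qed

text \<open>After symmetrisation the left-hand side is \<open>1 / \<tau> - 1\<close> times one
  Bregman distance plus \<open>1 / \<tau>\<close> times the other. For \<open>\<tau> \<le> 1\<close>
  both weights are nonnegative, so the descent lemma bounds both terms.\<close>

lemma gradient_step_bound_under_relaxed:
  fixes F :: "'a::real_inner \<Rightarrow> real"
  assumes deriv: "\<And>x. GDERIV F x :> G x" and lip: "L-lipschitz_on UNIV G"
    and "0 < \<tau>" "\<tau> \<le> 1"
  shows "(1 / \<tau>) * ((G x' - G x) \<bullet> (x' - x)) - bregman F G x x'
    \<le> ((2 - \<tau>) * L) / (2 * \<tau>) * (norm (x' - x))\<^sup>2"
proof -
  have "(1 / \<tau> - 1) * bregman F G x x' \<le> (1 / \<tau> - 1) * (L / 2 * (norm (x - x'))\<^sup>2)"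
    using bregman_le_lipschitz_gradient[OF deriv lip, of x x'] assms(3,4)
    by (intro mult_left_mono) auto
  moreover have "(1 / \<tau>) * bregman F G x' x \<le> (1 / \<tau>) * (L / 2 * (norm (x' - x))\<^sup>2)"
    using bregman_le_lipschitz_gradient[OF deriv lip, of x' x] \<open>0 < \<tau>\<close>
    by (intro mult_left_mono) auto
  moreover have "((2 - \<tau>) * L) / (2 * \<tau>) * (norm (x' - x))\<^sup>2
      = (1 / \<tau> - 1) * (L / 2 * (norm (x - x'))\<^sup>2) + (1 / \<tau>) * (L / 2 * (norm (x' - x))\<^sup>2)"
    using \<open>0 < \<tau>\<close> by (simp add: norm_minus_commute field_simps)
  moreover have "(1 / \<tau>) * (bregman F G x' x + bregman F G x x') - bregman F G x x'
      = (1 / \<tau> - 1) * bregman F G x x' + (1 / \<tau>) * bregman F G x' x"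
    by (simp add: algebra_simps)
  ultimately show ?thesis
    unfolding bregman_symmetrized[of F G x' x, symmetric] by (simp only: add_mono)
qed

text \<open>For \<open>\<tau> \<ge> 1\<close> the weight \<open>1 / \<tau> - 1\<close> is
  nonpositive, so its Bregman distance has to be bounded from below, by weak convexity.\<close>

lemma gradient_step_bound_over_relaxed:
  fixes F :: "'a::real_inner \<Rightarrow> real"
  assumes deriv: "\<And>x. GDERIV F x :> G x" and lip: "L-lipschitz_on UNIV G"
    and conv: "convex_on UNIV (\<lambda>x. F x + s / 2 * (norm x)\<^sup>2)"
    and "1 \<le> \<tau>"
  shows "(1 / \<tau>) * ((G x' - G x) \<bullet> (x' - x)) - bregman F G x x'
    \<le> (\<tau> * L + 2 * (\<tau> - 1) * s) / (2 * \<tau>) * (norm (x' - x))\<^sup>2"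
proof -
  define n where "n = (norm (x' - x))\<^sup>2"
  have lower: "- s / 2 * n \<le> bregman F G x x'" and upper: "bregman F G x x' \<le> L / 2 * n"
    using bregman_ge_weak_convexity[OF conv deriv, of x x']
      bregman_le_lipschitz_gradient[OF deriv lip, of x x']
    by (simp_all add: n_def norm_minus_commute)
  have "(\<tau> - 1) * (- s / 2 * n) \<le> (\<tau> - 1) * bregman F G x x'"
    using lower \<open>1 \<le> \<tau>\<close> by (intro mult_left_mono) auto
  \<comment> \<open>The direct estimate has the coefficient
    \<open>(L + (\<tau> - 1) * s) / (2 * \<tau>)\<close>. The stated one, which fits the
    admissibility conditions, is larger by
    \<open>(\<tau> - 1) * (L + s) / (2 * \<tau>)\<close>.\<close>
  moreover have "0 \<le> (L + s) / 2 * n"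
    using lower upper by (simp add: algebra_simps add_divide_distrib)
  then have "0 \<le> (\<tau> - 1) * ((L + s) / 2 * n)"
    using \<open>1 \<le> \<tau>\<close> by simp
  moreover have "bregman F G x' x \<le> L / 2 * n"
    using bregman_le_lipschitz_gradient[OF deriv lip, of x' x] by (simp add: n_def)
  ultimately have "bregman F G x' x + bregman F G x x' - \<tau> * bregman F G x x'
      \<le> (\<tau> * L + 2 * (\<tau> - 1) * s) / 2 * n"
    by (simp add: field_simps)
  then have "(1 / \<tau>) * (bregman F G x' x + bregman F G x x' - \<tau> * bregman F G x x')
      \<le> (1 / \<tau>) * ((\<tau> * L + 2 * (\<tau> - 1) * s) / 2 * n)"
    using \<open>1 \<le> \<tau>\<close> by (intro mult_left_mono) auto
  also have "(1 / \<tau>) * (bregman F G x' x + bregman F G x x' - \<tau> * bregman F G x x')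
      = (1 / \<tau>) * (bregman F G x' x + bregman F G x x') - bregman F G x x'"
    using \<open>1 \<le> \<tau>\<close> by (simp add: field_simps)
  finally show ?thesis
    unfolding bregman_symmetrized[of F G x' x, symmetric] n_def by simp
qed

text \<open>At a unit basis vector the lower and upper bounds on one Bregman distance are
  \<open>\<sigma> / 2\<close> and \<open>L / 2\<close>. This supplies
  \<open>\<sigma> \<le> Lf\<close> in case C.\<close>

lemma convexity_modulus_le_lipschitz:
  fixes F :: "'a::euclidean_space \<Rightarrow> real"
  assumes deriv: "\<And>x. GDERIV F x :> G x" and lip: "L-lipschitz_on UNIV G"
    and conv: "convex_on UNIV (\<lambda>x. F x - \<sigma> / 2 * (norm x)\<^sup>2)"
  shows "\<sigma> \<le> L"
proof -
  obtain b :: 'a where "b \<in> Basis"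
    by (meson SOME_Basis)
  then have "norm b = 1"
    by simp
  then show ?thesis
    using bregman_ge_weak_convexity[of F "- \<sigma>" G b 0] conv deriv
      bregman_le_lipschitz_gradient[OF deriv lip, of b 0] by simp
qed

text \<open>This is the merit function without \<open>g\<close> and \<open>p\<close>. Keeping
  \<open>x\<close> and \<open>y\<close> as separate arguments allows the \<open>y\<close>-update and
  the passage to the next \<open>x\<close> to be estimated one after the other.\<close>

definition smooth_model ::
  "('a::euclidean_space \<Rightarrow> real) \<Rightarrow> ('a \<Rightarrow> real) \<Rightarrow> real \<Rightarrow> 'a \<Rightarrow> 'a \<Rightarrow> real" where
  "smooth_model f h \<alpha> x y = f x + h x + (gradient f x + gradient h x) \<bullet> (y - x)
     + 1 / (2 * \<alpha>) * (norm (y - x))\<^sup>2"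

text \<open>The hypothesis \<open>step\<close> is the \<open>z\<close>-update after \<open>z\<close>
  has been replaced by \<open>x + \<alpha> *\<^sub>R gradient f x\<close>. Solving it for
  \<open>y - x\<close> eliminates \<open>y\<close>.\<close>

lemma smooth_model_difference:
  fixes f h :: "'a::euclidean_space \<Rightarrow> real"
  assumes "0 < \<tau>" "0 < \<alpha>"
    and step: "\<tau> *\<^sub>R (y - x) = (x' - x) + \<alpha> *\<^sub>R (gradient f x' - gradient f x)"
  defines "d \<equiv> x' - x" and "df \<equiv> gradient f x' - gradient f x"
    and "dh \<equiv> gradient h x' - gradient h x"
  shows "smooth_model f h \<alpha> x' y - smooth_model f h \<alpha> x y
    = (\<alpha> / \<tau> * (norm df)\<^sup>2 - bregman f (gradient f) x x')
      + ((1 / \<tau>) * (dh \<bullet> d) - bregman h (gradient h) x x')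
      + \<alpha> / \<tau> * (dh \<bullet> df) + 1 / (2 * \<alpha>) * (1 - 2 / \<tau>) * (norm d)\<^sup>2"
proof -
  define u where "u = (1 / \<tau>) *\<^sub>R (d + \<alpha> *\<^sub>R df)"
  have "y - x = (1 / \<tau>) *\<^sub>R (\<tau> *\<^sub>R (y - x))"
    using \<open>0 < \<tau>\<close> by simp
  also have "\<dots> = u"
    unfolding step u_def d_def df_def ..
  finally have yx: "y - x = u" .
  have yx': "y - x' = u - d"
    unfolding yx[symmetric] by (simp add: d_def)
  have du: "d \<bullet> u = (1 / \<tau>) * ((norm d)\<^sup>2 + \<alpha> * (df \<bullet> d))"
    and dfu: "df \<bullet> u = (1 / \<tau>) * (df \<bullet> d + \<alpha> * (norm df)\<^sup>2)"
    and dhu: "dh \<bullet> u = (1 / \<tau>) * (dh \<bullet> d + \<alpha> * (dh \<bullet> df))"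
    unfolding u_def power2_norm_eq_inner by (simp_all add: inner_add_right inner_commute)
  have ud: "(norm (u - d))\<^sup>2 = (norm u)\<^sup>2 - 2 * (d \<bullet> u) + (norm d)\<^sup>2"
    unfolding power2_norm_eq_inner by (simp add: inner_diff inner_commute)
  have model: "smooth_model f h \<alpha> x' y - smooth_model f h \<alpha> x y
    = (f x' - f x - gradient f x' \<bullet> d) + (h x' - h x - gradient h x' \<bullet> d) + df \<bullet> u + dh \<bullet> u
      + 1 / (2 * \<alpha>) * ((norm d)\<^sup>2 - 2 * (d \<bullet> u))"
    unfolding smooth_model_def yx yx' ud df_def dh_def by (simp add: inner_add_left inner_diff algebra_simps)
  have breg: "bregman f (gradient f) x x' = - (f x' - f x - gradient f x' \<bullet> d)"
    "bregman h (gradient h) x x' = - (h x' - h x - gradient h x' \<bullet> d)"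
    unfolding bregman_def d_def by (simp_all add: inner_diff_right)
  show ?thesis
    unfolding model breg du dfu dhu using assms(1,2) by (simp add: field_simps)
qed

lemma smooth_model_decrease:
  assumes f: "L_smooth Lf f" and h: "L_smooth Lh h"
    and "0 < \<tau>" "0 < \<alpha>"
    and f_bound: "\<And>x x'. \<alpha> / \<tau> * (norm (gradient f x' - gradient f x))\<^sup>2
        - bregman f (gradient f) x x' \<le> ef * (norm (x' - x))\<^sup>2"
    and h_bound: "\<And>x x'. (1 / \<tau>) * ((gradient h x' - gradient h x) \<bullet> (x' - x))
        - bregman h (gradient h) x x' \<le> eh * (norm (x' - x))\<^sup>2"
    and neg: "2 * \<alpha> * \<tau> * (ef + eh) + 2 * \<alpha>\<^sup>2 * (Lf * Lh) - (2 - \<tau>) < 0"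
  obtains \<kappa> where "0 < \<kappa>"
    and "\<And>x x' y. \<tau> *\<^sub>R (y - x) = (x' - x) + \<alpha> *\<^sub>R (gradient f x' - gradient f x) \<Longrightarrow>
      smooth_model f h \<alpha> x' y \<le> smooth_model f h \<alpha> x y - \<kappa> * (norm (x' - x))\<^sup>2"
proof -
  \<comment> \<open>Minus the total coefficient of \<open>(norm (x' - x))\<^sup>2\<close> once the
    mixed term is bounded by Cauchy-Schwarz; multiplication by \<open>2 * \<alpha> * \<tau>\<close>
    turns \<open>0 < \<kappa>\<close> into \<open>neg\<close>.\<close>
  define \<kappa> where "\<kappa> = - (ef + eh + \<alpha> / \<tau> * (Lf * Lh) + 1 / (2 * \<alpha>) * (1 - 2 / \<tau>))"
  have "2 * \<alpha> * \<tau> * \<kappa> = - (2 * \<alpha> * \<tau> * (ef + eh) + 2 * \<alpha>\<^sup>2 * (Lf * Lh) - (2 - \<tau>))"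
    using \<open>0 < \<tau>\<close> \<open>0 < \<alpha>\<close> by (simp add: \<kappa>_def field_simps power2_eq_square)
  then have "0 < 2 * \<alpha> * \<tau> * \<kappa>"
    using neg by linarith
  then have "0 < \<kappa>"
    by (rule zero_less_mult_pos) (use \<open>0 < \<tau>\<close> \<open>0 < \<alpha>\<close> in simp)
  moreover have "smooth_model f h \<alpha> x' y \<le> smooth_model f h \<alpha> x y - \<kappa> * (norm (x' - x))\<^sup>2"
    if step: "\<tau> *\<^sub>R (y - x) = (x' - x) + \<alpha> *\<^sub>R (gradient f x' - gradient f x)" for x x' y
  proof -
    let ?df = "gradient f x' - gradient f x" and ?dh = "gradient h x' - gradient h x"
    have "?dh \<bullet> ?df \<le> norm ?dh * norm ?df"
      by (rule norm_cauchy_schwarz)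
    also have "\<dots> \<le> (Lh * norm (x' - x)) * (Lf * norm (x' - x))"
      using lipschitz_on_norm_le[OF L_smooth_lipschitz[OF f]]
        lipschitz_on_norm_le[OF L_smooth_lipschitz[OF h]] L_smooth_nonneg[OF h]
      by (intro mult_mono) auto
    finally have "\<alpha> / \<tau> * (?dh \<bullet> ?df) \<le> \<alpha> / \<tau> * (Lf * Lh * (norm (x' - x))\<^sup>2)"
      using \<open>0 < \<tau>\<close> \<open>0 < \<alpha>\<close> by (intro mult_left_mono) (auto simp: power2_eq_square mult_ac)
    then show ?thesis
      using smooth_model_difference[OF \<open>0 < \<tau>\<close> \<open>0 < \<alpha>\<close> step, of h] f_bound[of x' x] h_bound[of x' x]
      by (simp add: \<kappa>_def algebra_simps)
  qed
  ultimately show thesis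
    using that by blast
qed

lemma admissible_pair_smooth_model_decrease:
  fixes f h :: "'a::euclidean_space \<Rightarrow> real"
  assumes f: "L_smooth Lf f" and h: "L_smooth Lh h"
    and wc: "weakly_convex \<rho> f" and "\<rho> \<le> Lf" and "0 < Lf + Lh"
    and adm: "admissible_pair f h Lf Lh \<rho> \<tau> \<alpha>"
  obtains \<kappa> where "0 < \<kappa>"
    and "\<And>x x' y. \<tau> *\<^sub>R (y - x) = (x' - x) + \<alpha> *\<^sub>R (gradient f x' - gradient f x) \<Longrightarrow>
      smooth_model f h \<alpha> x' y \<le> smooth_model f h \<alpha> x y - \<kappa> * (norm (x' - x))\<^sup>2"
proof -
  note fD = L_smooth_GDERIV[OF f] and fL = L_smooth_lipschitz[OF f]
  note hD = L_smooth_GDERIV[OF h] and hL = L_smooth_lipschitz[OF h]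
  note nonneg = L_smooth_nonneg[OF f] L_smooth_nonneg[OF h]
  have \<tau>: "0 < \<tau>" and \<alpha>: "0 < \<alpha>"
    using adm by (auto simp: admissible_pair_def)
  have \<rho>: "0 \<le> \<rho>" and conv: "convex_on UNIV (\<lambda>x. f x + \<rho> / 2 * (norm x)\<^sup>2)"
    using wc by (auto simp: weakly_convex_def)
  note conclusion = that
  note decrease = smooth_model_decrease[OF f h \<tau> \<alpha>]
  have c: "0 \<le> \<alpha> / \<tau>"
    using \<tau> \<alpha> by simp
  note f_bounds = weakly_convex_gradient_difference_bound[OF conv fD fL \<rho> c]
  \<comment> \<open>Cases A and B lead to the same dichotomy between the two rates and differ only
    in \<open>H\<close>, the bound on the contribution of \<open>h\<close>.\<close>
  have AB: thesis
    if rate: "(\<tau> \<le> 2 * \<alpha> * (Lf - \<rho>) \<and> rate_smooth Lf Lh \<tau> H \<alpha> < 0) \<or>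
      (2 * \<alpha> * (Lf - \<rho>) \<le> \<tau> \<and> rate_weak Lf Lh \<rho> \<tau> H \<alpha> < 0)"
    and h_bound: "\<And>x x'. (1 / \<tau>) * ((gradient h x' - gradient h x) \<bullet> (x' - x))
        - bregman h (gradient h) x x' \<le> H / (2 * \<tau>) * (norm (x' - x))\<^sup>2" for H
    using rate
  proof (elim disjE conjE)
    assume "\<tau> \<le> 2 * \<alpha> * (Lf - \<rho>)" and neg: "rate_smooth Lf Lh \<tau> H \<alpha> < 0"
    then have "1 \<le> 2 * (\<alpha> / \<tau>) * (Lf - \<rho>)"
      using \<tau> by (simp add: field_simps)
    from f_bounds(2)[OF this] show thesis
    proof (rule decrease[OF _ h_bound _ conclusion])
      have "2 * \<alpha> * \<tau> * (\<alpha> / \<tau> * Lf\<^sup>2 - Lf / 2 + H / (2 * \<tau>)) + 2 * \<alpha>\<^sup>2 * (Lf * Lh) - (2 - \<tau>)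
          = rate_smooth Lf Lh \<tau> H \<alpha>"
        using \<tau> by (simp add: rate_smooth_def field_simps power2_eq_square)
      then show "2 * \<alpha> * \<tau> * (\<alpha> / \<tau> * Lf\<^sup>2 - Lf / 2 + H / (2 * \<tau>)) + 2 * \<alpha>\<^sup>2 * (Lf * Lh) - (2 - \<tau>) < 0"
        using neg by simp
    qed
  next
    assume "2 * \<alpha> * (Lf - \<rho>) \<le> \<tau>" and neg: "rate_weak Lf Lh \<rho> \<tau> H \<alpha> < 0"
    then have "2 * (\<alpha> / \<tau>) * (Lf - \<rho>) \<le> 1"
      using \<tau> by (simp add: field_simps)
    from f_bounds(1)[OF this] show thesis
    proof (rule decrease[OF _ h_bound _ conclusion])
      have "2 * \<alpha> * \<tau> * (\<rho> / 2 + \<alpha> / \<tau> * \<rho>\<^sup>2 + H / (2 * \<tau>)) + 2 * \<alpha>\<^sup>2 * (Lf * Lh) - (2 - \<tau>)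
          = rate_weak Lf Lh \<rho> \<tau> H \<alpha>"
        using \<tau> by (simp add: rate_weak_def field_simps power2_eq_square)
      then show "2 * \<alpha> * \<tau> * (\<rho> / 2 + \<alpha> / \<tau> * \<rho>\<^sup>2 + H / (2 * \<tau>)) + 2 * \<alpha>\<^sup>2 * (Lf * Lh) - (2 - \<tau>) < 0"
        using neg by simp
    qed
  qed
  consider (A) "admissible_A Lf Lh \<rho> \<tau> \<alpha>" | (B) "admissible_B h Lf Lh \<rho> \<tau> \<alpha>"
    | (C) "admissible_C f h Lf Lh \<tau> \<alpha>"
    using adm by (auto simp: admissible_pair_def)
  then show thesis
  proof cases
    case A
    then have "\<tau> \<le> 1"
      by (simp add: admissible_A_def)
    show thesis
      by (rule AB[OF admissible_A_rate_negative[OF nonneg assms(5) \<rho> assms(4) A]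
            gradient_step_bound_under_relaxed[OF hD hL \<tau> \<open>\<tau> \<le> 1\<close>]])
  next
    case B
    then have "1 \<le> \<tau>"
      by (simp add: admissible_B_def)
    from B obtain \<sigma> where "convex_on UNIV (\<lambda>x. h x - \<sigma> / 2 * (norm x)\<^sup>2)"
      and rate: "(\<tau> \<le> 2 * \<alpha> * (Lf - \<rho>)
          \<and> rate_smooth Lf Lh \<tau> (\<tau> * Lh - 2 * (\<tau> - 1) * \<sigma>) \<alpha> < 0) \<or>
        (2 * \<alpha> * (Lf - \<rho>) \<le> \<tau> \<and> rate_weak Lf Lh \<rho> \<tau> (\<tau> * Lh - 2 * (\<tau> - 1) * \<sigma>) \<alpha> < 0)"
      by (rule admissible_B_rate_negative[OF nonneg \<rho> \<open>\<rho> \<le> Lf\<close>])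
    then have "convex_on UNIV (\<lambda>x. h x + - \<sigma> / 2 * (norm x)\<^sup>2)"
      by simp
    from gradient_step_bound_over_relaxed[OF hD hL this \<open>1 \<le> \<tau>\<close>] show thesis
      by (intro AB[OF rate]) simp
  next
    case C
    obtain \<sigma> \<rho>h where \<sigma>: "0 < \<sigma>" "\<sigma> \<le> Lf" "convex_on UNIV (\<lambda>x. f x - \<sigma> / 2 * (norm x)\<^sup>2)"
      and h_conv: "convex_on UNIV (\<lambda>x. h x + \<rho>h / 2 * (norm x)\<^sup>2)"
      and "2 \<le> \<tau>" "0 < \<alpha>" and cL: "2 * (\<alpha> / \<tau>) * Lf \<le> 1"
      and neg: "2 * (\<sigma> * Lf + Lf * Lh) * \<alpha>\<^sup>2
        + (\<tau> * Lh + 2 * (\<tau> - 1) * \<rho>h - \<sigma> * \<tau>) * \<alpha> - (2 - \<tau>) < 0"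
      by (rule admissible_C_rate_negative[OF nonneg convexity_modulus_le_lipschitz[OF fD fL] C])
    have "1 \<le> \<tau>"
      using \<open>2 \<le> \<tau>\<close> by simp
    show thesis
    proof (rule decrease[OF strongly_convex_gradient_difference_bound[OF \<sigma>(3) fD fL _ c cL]
            gradient_step_bound_over_relaxed[OF hD hL h_conv \<open>1 \<le> \<tau>\<close>] _ conclusion])
      have "2 * \<alpha> * \<tau> * (\<alpha> / \<tau> * \<sigma> * Lf - \<sigma> / 2 + (\<tau> * Lh + 2 * (\<tau> - 1) * \<rho>h) / (2 * \<tau>))
          + 2 * \<alpha>\<^sup>2 * (Lf * Lh) - (2 - \<tau>)
        = 2 * (\<sigma> * Lf + Lf * Lh) * \<alpha>\<^sup>2
        + (\<tau> * Lh + 2 * (\<tau> - 1) * \<rho>h - \<sigma> * \<tau>) * \<alpha> - (2 - \<tau>)"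
        using \<tau> by (simp add: field_simps power2_eq_square)
      then show "2 * \<alpha> * \<tau> * (\<alpha> / \<tau> * \<sigma> * Lf - \<sigma> / 2 + (\<tau> * Lh + 2 * (\<tau> - 1) * \<rho>h) / (2 * \<tau>))
          + 2 * \<alpha>\<^sup>2 * (Lf * Lh) - (2 - \<tau>) < 0"
        using neg by simp
    qed (use \<sigma> in auto)
  qed
qed

section \<open>Proximal mappings and limiting subgradients\<close>

lemma lower_semicontinuous_eventually_gt:
  assumes "lower_semicontinuous \<phi>" "c < \<phi> x" "X \<longlonglongrightarrow> x"
  shows "\<forall>\<^sub>F k in sequentially. c < \<phi> (X k)"
proof -
  have "c < Liminf (at x) \<phi>"
    using assms(1,2) by (metis lower_semicontinuous_def less_le_trans)
  then have "\<forall>\<^sub>F y in at x. c < \<phi> y"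
    by (rule less_LiminfD)
  \<comment> \<open>The filter \<open>at x\<close> leaves out \<open>x\<close> itself, where
    \<open>c < \<phi> x\<close> holds by assumption.\<close>
  then have "\<forall>\<^sub>F y in nhds x. c < \<phi> y"
    using assms(2) by (auto simp: eventually_at_filter elim!: eventually_mono)
  then show ?thesis
    using assms(3) by (rule eventually_compose_filterlim)
qed

lemma continuous_imp_lower_semicontinuous:
  fixes f :: "'a::euclidean_space \<Rightarrow> real"
  assumes "continuous_on UNIV f"
  shows "lower_semicontinuous (\<lambda>u. ereal (f u))"
proof -
  have "Liminf (at x) (\<lambda>u. ereal (f u)) = ereal (f x)" for x
    using assms by (intro lim_imp_Liminf)
      (auto simp: continuous_on_eq_continuous_at isCont_def at_neq_bot intro!: tendsto_ereal)
  then show ?thesis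
    by (simp add: lower_semicontinuous_def)
qed

lemma proxD:
  assumes "w \<in> prox \<gamma> \<phi> x"
  shows "\<phi> w + ereal (1 / (2 * \<gamma>) * (norm (w - x))\<^sup>2)
    \<le> \<phi> u + ereal (1 / (2 * \<gamma>) * (norm (u - x))\<^sup>2)"
  using assms by (simp add: prox_def is_arg_min_linorder)

lemma proper_prox_finite:
  assumes "proper \<phi>" "w \<in> prox \<gamma> \<phi> x"
  shows "\<phi> w = ereal (real_of_ereal (\<phi> w))"
proof -
  obtain u where "\<phi> u < \<infinity>"
    using \<open>proper \<phi>\<close> by (auto simp: proper_def domain_def)
  then have "\<phi> u + ereal (1 / (2 * \<gamma>) * (norm (u - x))\<^sup>2) < \<infinity>"
    by simp
  with proxD[OF assms(2), of u] have "\<phi> w + ereal (1 / (2 * \<gamma>) * (norm (w - x))\<^sup>2) < \<infinity>"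
    by (rule le_less_trans)
  then have "\<phi> w \<noteq> \<infinity>"
    by auto
  moreover have "\<phi> w \<noteq> - \<infinity>"
    using \<open>proper \<phi>\<close> by (simp add: proper_def)
  ultimately show ?thesis
    by (cases "\<phi> w") auto
qed

text \<open>Minimality of \<open>X k\<close> bounds \<open>\<phi> (X k)\<close> above by a
  convergent real sequence, and lower semicontinuity carries this bound over to
  \<open>\<phi> x\<close>.\<close>

lemma prox_closed_graph:
  assumes lsc: "lower_semicontinuous \<phi>" and "proper \<phi>"
    and X: "X \<longlonglongrightarrow> x" and U: "U \<longlonglongrightarrow> u" and mem: "\<And>k. X k \<in> prox \<gamma> \<phi> (U k)"
  shows "x \<in> prox \<gamma> \<phi> u"
proof -
  define q where "q v w = 1 / (2 * \<gamma>) * (norm (v - w))\<^sup>2" for v w :: 'a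
  have "\<phi> x + ereal (q x u) \<le> \<phi> w + ereal (q w u)" for w
  proof (rule ccontr)
    assume contr: "\<not> ?thesis"
    then have "\<phi> w < \<infinity>"
      by auto
    then obtain a where a: "\<phi> w = ereal a"
      using \<open>proper \<phi>\<close> by (cases "\<phi> w") (auto simp: proper_def)
    have "ereal (a + q w u - q x u) < \<phi> x"
      using contr a by (cases "\<phi> x") auto
    then obtain c where c: "ereal (a + q w u - q x u) < ereal c" "ereal c < \<phi> x"
      using ereal_dense2 by blast
    have "(\<lambda>k. a + q w (U k) - q (X k) (U k)) \<longlonglongrightarrow> a + q w u - q x u"
      unfolding q_def by (intro tendsto_intros X U)
    then have "\<forall>\<^sub>F k in sequentially. a + q w (U k) - q (X k) (U k) < c"
      by (rule order_tendstoD) (use c in simp)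
    moreover have "\<forall>\<^sub>F k in sequentially. ereal c < \<phi> (X k)"
      by (rule lower_semicontinuous_eventually_gt[OF lsc c(2) X])
    ultimately have "\<forall>\<^sub>F k in sequentially. False"
    proof eventually_elim
      case (elim k)
      have "\<phi> (X k) + ereal (q (X k) (U k)) \<le> ereal (a + q w (U k))"
        using proxD[OF mem[of k], of w] by (simp add: q_def a)
      then have "\<phi> (X k) \<le> ereal (a + q w (U k) - q (X k) (U k))"
        by (cases "\<phi> (X k)") auto
      also have "\<dots> < ereal c"
        using elim(1) by simp
      finally show False
        using elim(2) by simp
    qed
    then show False
      by simp
  qed
  then show ?thesis
    by (simp add: prox_def is_arg_min_linorder q_def)
qed

text \<open>Fermat's rule for the prox objective. It expresses \<open>z\<close> through
  \<open>x\<close>, so the merit function can be written in \<open>x\<close> and \<open>y\<close>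
  alone.\<close>

lemma prox_smooth_gradient:
  assumes f: "L_smooth L f" and "0 < \<alpha>" and "x \<in> prox \<alpha> (\<lambda>u. ereal (f u)) z"
  shows "\<alpha> *\<^sub>R gradient f x = z - x"
proof -
  define m where "m u = f u + 1 / \<alpha> / 2 * (norm (u - z))\<^sup>2" for u
  have "GDERIV (\<lambda>u. 1 / \<alpha> / 2 * (norm (u - z))\<^sup>2) x :> (1 / \<alpha>) *\<^sub>R (x - z)"
    unfolding gderiv_def power2_norm_eq_inner using \<open>0 < \<alpha>\<close>
    by (auto intro!: derivative_eq_intros ext simp: inner_commute)
  then have "GDERIV m x :> gradient f x + (1 / \<alpha>) *\<^sub>R (x - z)"
    unfolding m_def by (intro GDERIV_add L_smooth_GDERIV[OF f])
  moreover have "\<forall>\<^sub>F u in at x. m x \<le> m u"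
    using proxD[OF assms(3)] by (simp add: m_def mult.commute)
  ultimately have "(\<lambda>h. h \<bullet> (gradient f x + (1 / \<alpha>) *\<^sub>R (x - z))) = (\<lambda>h. 0)"
    unfolding gderiv_def by (rule has_derivative_local_min)
  then have "gradient f x + (1 / \<alpha>) *\<^sub>R (x - z) = 0"
    by (metis inner_eq_zero_iff)
  then have "\<alpha> *\<^sub>R (gradient f x + (1 / \<alpha>) *\<^sub>R (x - z)) = 0"
    by simp
  then have "\<alpha> *\<^sub>R gradient f x + (x - z) = 0"
    using \<open>0 < \<alpha>\<close> by (simp add: scaleR_add_right)
  then show ?thesis
    by (simp add: algebra_simps eq_neg_iff_add_eq_0)
qed

text \<open>A regular subgradient \<open>\<xi>\<close> is tested at \<open>y - t *\<^sub>R (w - y)\<close>, on the far side of \<open>y\<close>; convexity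
  of \<open>\<lambda>u. - p u + \<rho> / 2 * (norm u)\<^sup>2\<close> along the line carries the estimate over to \<open>w\<close>.\<close>

lemma regular_subgradient_upper_bound:
  fixes p :: "'a::euclidean_space \<Rightarrow> real"
  assumes wc: "weakly_convex \<rho> (\<lambda>u. - p u)"
    and \<xi>: "\<xi> \<in> regular_subdifferential (\<lambda>u. ereal (p u)) y"
  shows "p w \<le> p y + \<xi> \<bullet> (w - y) + \<rho> / 2 * (norm (w - y))\<^sup>2"
proof (cases "w = y")
  case False
  define e where "e = w - y"
  have e: "0 < norm e"
    using False by (simp add: e_def)
  define c where "c u = - p u + \<rho> / 2 * (norm u)\<^sup>2" for u
  have conv: "convex_on UNIV c"
    using wc by (simp add: weakly_convex_def c_def[abs_def])
  have "p w \<le> p y + \<xi> \<bullet> e + \<rho> / 2 * (norm e)\<^sup>2 + \<epsilon>" if "0 < \<epsilon>" for \<epsilon>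
  proof -
    \<comment> \<open>The slope error \<open>\<delta>\<close> uses half of the allowance
      \<open>\<epsilon>\<close>; the other half is reserved for the quadratic remainder.\<close>
    define \<delta> where "\<delta> = \<epsilon> / (2 * norm e)"
    have \<delta>: "0 < \<delta>" "\<delta> * norm e = \<epsilon> / 2"
      using that e by (auto simp: \<delta>_def)
    have "0 \<le> Liminf (at y) (\<lambda>u. (ereal (p u) - ereal (p y) - ereal (\<xi> \<bullet> (u - y))) / ereal (norm (u - y)))"
      using \<xi> by (simp add: regular_subdifferential_def)
    moreover have "ereal (- \<delta>) < 0"
      using \<delta>(1) by simp
    ultimately have "\<forall>\<^sub>F u in at y. ereal (- \<delta>)
        < (ereal (p u) - ereal (p y) - ereal (\<xi> \<bullet> (u - y))) / ereal (norm (u - y))"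
      unfolding le_Liminf_iff by blast
    then obtain r where r: "0 < r" and near: "\<And>u. u \<noteq> y \<Longrightarrow> dist u y < r \<Longrightarrow> ereal (- \<delta>)
        < (ereal (p u) - ereal (p y) - ereal (\<xi> \<bullet> (u - y))) / ereal (norm (u - y))"
      unfolding eventually_at by auto
    have lower: "p y + \<xi> \<bullet> (u - y) - \<delta> * norm (u - y) \<le> p u" if "u \<noteq> y" "dist u y < r" for u
    proof -
      have "- \<delta> < (p u - p y - \<xi> \<bullet> (u - y)) / norm (u - y)"
        using near[OF that] that(1) by simp
      then have "- \<delta> * norm (u - y) < p u - p y - \<xi> \<bullet> (u - y)"
        using that(1) by (simp add: pos_less_divide_eq)
      then show ?thesis
        by simp
    qed
    \<comment> \<open>The first bound on \<open>t\<close> keeps the test point within distance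
      \<open>r\<close> of \<open>y\<close>, the second makes the remainder at most
      \<open>\<epsilon> / 2\<close>. The summand \<open>1\<close> keeps \<open>b\<close> positive
      when \<open>\<rho> = 0\<close>.\<close>
    define b where "b = \<bar>\<rho>\<bar> * (norm e)\<^sup>2 + 1"
    define t where "t = min (r / (2 * norm e)) (\<epsilon> / b)"
    have b: "0 < b"
      by (simp add: b_def add_nonneg_pos)
    have t: "0 < t"
      using r e that b by (simp add: t_def)
    have "t * norm e \<le> r / (2 * norm e) * norm e"
      by (intro mult_right_mono) (auto simp: t_def)
    also have "\<dots> < r"
      using r e by simp
    finally have t_r: "t * norm e < r" .
    have "t * b \<le> \<epsilon> / b * b"
      using b by (intro mult_right_mono) (auto simp: t_def)
    then have "t * (\<bar>\<rho>\<bar> * (norm e)\<^sup>2) + t \<le> \<epsilon>"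
      using b by (simp add: distrib_left b_def[symmetric]) (simp add: b_def distrib_left)
    moreover have "t * (\<rho> * (norm e)\<^sup>2) \<le> t * (\<bar>\<rho>\<bar> * (norm e)\<^sup>2)"
      using t by (intro mult_left_mono mult_right_mono) auto
    moreover have "\<rho> / 2 * (t * (norm e)\<^sup>2) = t * (\<rho> * (norm e)\<^sup>2) / 2"
      by simp
    ultimately have t_\<rho>: "\<rho> / 2 * (t * (norm e)\<^sup>2) \<le> \<epsilon> / 2"
      using t by linarith
    define u where "u = y - t *\<^sub>R e"
    have "p y - t * (\<xi> \<bullet> e) - t * (\<delta> * norm e) \<le> p u"
      using lower[of u] t t_r e by (simp add: u_def dist_norm mult_ac)
    then have pu: "p y - t * (\<xi> \<bullet> e) - t * (\<epsilon> / 2) \<le> p u"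
      unfolding \<delta>(2) .
    \<comment> \<open>This weight makes \<open>y\<close> the convex combination of the test point
      \<open>u\<close> and \<open>w\<close>.\<close>
    define s where "s = t / (1 + t)"
    have s: "0 \<le> s" "s \<le> 1" "(1 + t) * s = t" "(1 + t) * (1 - s) = 1"
      using t by (simp_all add: s_def field_simps)
    have "(1 + t) *\<^sub>R ((1 - s) *\<^sub>R u + s *\<^sub>R w) = u + t *\<^sub>R w"
      by (simp only: scaleR_add_right scaleR_scaleR s scaleR_one)
    also have "\<dots> = (1 + t) *\<^sub>R y"
      by (simp add: u_def e_def algebra_simps)
    finally have "y = (1 - s) *\<^sub>R u + s *\<^sub>R w"
      using t by simp
    then have "c y \<le> (1 - s) * c u + s * c w"
      using convex_onD[OF conv, of s u w] s by simp
    then have "(1 + t) * c y \<le> (1 + t) * ((1 - s) * c u + s * c w)"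
      using t by (intro mult_left_mono) auto
    also have "\<dots> = c u + t * c w"
      by (simp only: distrib_left mult.assoc[symmetric] s mult_1)
    finally have main: "(1 + t) * c y \<le> c u + t * c w" .
    have norm_w: "(norm w)\<^sup>2 = (norm y)\<^sup>2 + 2 * (y \<bullet> e) + (norm e)\<^sup>2"
    proof -
      have "w = y + e"
        by (simp add: e_def)
      then show ?thesis
        unfolding power2_norm_eq_inner by (simp add: inner_add inner_commute)
    qed
    have norm_u: "(norm u)\<^sup>2 = (norm y)\<^sup>2 - 2 * t * (y \<bullet> e) + t\<^sup>2 * (norm e)\<^sup>2"
      unfolding power2_norm_eq_inner u_def
      by (simp add: inner_diff inner_commute power2_eq_square)
    have "t * p w \<le> t * (p y) + (p y - p u)
        + \<rho> / 2 * t * (norm e)\<^sup>2 + \<rho> / 2 * t\<^sup>2 * (norm e)\<^sup>2"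
      using main unfolding c_def norm_w norm_u by (simp add: field_simps)
    also have "\<dots> \<le> t * (p y + \<xi> \<bullet> e + \<epsilon> / 2 + \<rho> / 2 * (norm e)\<^sup>2 + \<rho> / 2 * (t * (norm e)\<^sup>2))"
      using pu by (simp add: algebra_simps power2_eq_square)
    finally have "p w \<le> p y + \<xi> \<bullet> e + \<epsilon> / 2 + \<rho> / 2 * (norm e)\<^sup>2 + \<rho> / 2 * (t * (norm e)\<^sup>2)"
      using t by (rule mult_left_le_imp_le)
    then show ?thesis
      using t_\<rho> by simp
  qed
  then show ?thesis
    unfolding e_def by (rule field_le_epsilon)
qed simp

text \<open>A finite convex function on a whole Euclidean space is continuous, and \<open>p\<close>
  is a quadratic minus such a function.\<close>

lemma weakly_convex_continuous:
  fixes p :: "'a::euclidean_space \<Rightarrow> real"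
  assumes "weakly_convex \<rho> (\<lambda>u. - p u)"
  shows "continuous_on UNIV p"
proof -
  have "continuous_on UNIV (\<lambda>u. - p u + \<rho> / 2 * (norm u)\<^sup>2)"
    using assms by (intro convex_on_continuous) (auto simp: weakly_convex_def)
  then have "continuous_on UNIV (\<lambda>u. \<rho> / 2 * (norm u)\<^sup>2 - (- p u + \<rho> / 2 * (norm u)\<^sup>2))"
    by (rule continuous_on_diff[rotated]) (intro continuous_intros)
  then show ?thesis
    by simp
qed

lemma continuous_on_UNIV_tendsto:
  assumes "continuous_on UNIV f" "X \<longlonglongrightarrow> x"
  shows "(\<lambda>k. f (X k)) \<longlonglongrightarrow> f x"
  by (rule continuous_on_tendsto_compose[OF assms]) simp_all

lemma limiting_subgradient_upper_bound:
  fixes p :: "'a::euclidean_space \<Rightarrow> real"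
  assumes wc: "weakly_convex \<rho> (\<lambda>u. - p u)"
    and "\<xi> \<in> limiting_subdifferential (\<lambda>u. ereal (p u)) y"
  shows "p w \<le> p y + \<xi> \<bullet> (w - y) + \<rho> / 2 * (norm (w - y))\<^sup>2"
proof -
  obtain X \<Xi> where X: "X \<longlonglongrightarrow> y" and \<Xi>: "\<Xi> \<longlonglongrightarrow> \<xi>"
    and mem: "\<And>k. \<Xi> k \<in> regular_subdifferential (\<lambda>u. ereal (p u)) (X k)"
    using assms(2) by (auto simp: limiting_subdifferential_def)
  have "(\<lambda>k. p (X k) + \<Xi> k \<bullet> (w - X k) + \<rho> / 2 * (norm (w - X k))\<^sup>2)
      \<longlonglongrightarrow> p y + \<xi> \<bullet> (w - y) + \<rho> / 2 * (norm (w - y))\<^sup>2"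
    by (intro tendsto_intros X \<Xi> continuous_on_UNIV_tendsto[OF weakly_convex_continuous[OF wc]])
  then show ?thesis
    by (rule LIMSEQ_le_const) (use regular_subgradient_upper_bound[OF wc mem] in blast)
qed

lemma limiting_subdifferential_closed_graph:
  fixes p :: "'a::euclidean_space \<Rightarrow> real"
  assumes cont: "continuous_on UNIV p" and Y: "Y \<longlonglongrightarrow> y" and \<Xi>: "\<Xi> \<longlonglongrightarrow> \<xi>"
    and mem: "\<And>k. \<Xi> k \<in> limiting_subdifferential (\<lambda>u. ereal (p u)) (Y k)"
  shows "\<xi> \<in> limiting_subdifferential (\<lambda>u. ereal (p u)) y"
proof -
  \<comment> \<open>A diagonal choice: each limiting subgradient is replaced by a regular one that
    is close in base point and in value. Continuity of \<open>p\<close> then yields convergence of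
    the function values.\<close>
  have "\<exists>u \<zeta>. dist u (Y k) < 1 / Suc k \<and> dist \<zeta> (\<Xi> k) < 1 / Suc k
      \<and> \<zeta> \<in> regular_subdifferential (\<lambda>u. ereal (p u)) u" for k
  proof -
    obtain U Z where "U \<longlonglongrightarrow> Y k" "Z \<longlonglongrightarrow> \<Xi> k"
      and reg: "\<And>j. Z j \<in> regular_subdifferential (\<lambda>u. ereal (p u)) (U j)"
      using mem[of k] by (auto simp: limiting_subdifferential_def)
    then have "\<forall>\<^sub>F j in sequentially. dist (U j) (Y k) < 1 / Suc k"
      and "\<forall>\<^sub>F j in sequentially. dist (Z j) (\<Xi> k) < 1 / Suc k"
      by (auto intro!: tendstoD)
    then have "\<forall>\<^sub>F j in sequentially. dist (U j) (Y k) < 1 / Suc k \<and> dist (Z j) (\<Xi> k) < 1 / Suc k"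
      by eventually_elim simp
    then show ?thesis
      using reg by (auto dest!: eventually_happens)
  qed
  then obtain U Z where U: "\<And>k. dist (U k) (Y k) < 1 / Suc k" and Z: "\<And>k. dist (Z k) (\<Xi> k) < 1 / Suc k"
    and reg: "\<And>k. Z k \<in> regular_subdifferential (\<lambda>u. ereal (p u)) (U k)"
    by metis
  have lim: "V \<longlonglongrightarrow> v" if "W \<longlonglongrightarrow> v" "\<And>k. dist (V k) (W k) < 1 / Suc k" for V W :: "nat \<Rightarrow> 'a" and v
  proof -
    have "(\<lambda>k. dist (V k) (W k)) \<longlonglongrightarrow> 0"
      by (rule tendsto_sandwich[OF _ _ tendsto_const LIMSEQ_Suc[OF lim_1_over_n]])
        (use that(2) in \<open>auto intro!: always_eventually less_imp_le\<close>)
    then have "(\<lambda>k. V k - W k) \<longlonglongrightarrow> 0"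
      by (simp add: dist_norm tendsto_norm_zero_iff)
    with that(1) show ?thesis
      by (rule Lim_transform)
  qed
  have "U \<longlonglongrightarrow> y" "Z \<longlonglongrightarrow> \<xi>"
    using lim[OF Y U] lim[OF \<Xi> Z] by auto
  moreover from \<open>U \<longlonglongrightarrow> y\<close> have "(\<lambda>k. ereal (p (U k))) \<longlonglongrightarrow> ereal (p y)"
    by (intro tendsto_ereal continuous_on_UNIV_tendsto[OF cont])
  ultimately show ?thesis
    using reg by (auto simp: limiting_subdifferential_def)
qed

lemma limiting_subgradients_bounded:
  fixes p :: "'a::euclidean_space \<Rightarrow> real"
  assumes wc: "weakly_convex \<rho> (\<lambda>u. - p u)" and Y: "Y \<longlonglongrightarrow> y"
    and mem: "\<And>k. \<Xi> k \<in> limiting_subdifferential (\<lambda>u. ereal (p u)) (Y k)"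
  shows "bounded (range \<Xi>)"
proof -
  have "bounded (range Y)"
    using Y by (rule convergent_imp_bounded)
  then obtain R where R: "\<And>k. norm (Y k) \<le> R"
    by (auto simp: bounded_iff)
  have "compact (p ` cball 0 (R + 1))"
    by (intro compact_continuous_image continuous_on_subset[OF weakly_convex_continuous[OF wc]]) auto
  then obtain B where B: "\<And>u. norm u \<le> R + 1 \<Longrightarrow> \<bar>p u\<bar> \<le> B"
    using compact_imp_bounded by (force simp: bounded_iff)
  have "norm (\<Xi> k) \<le> 2 * B + \<rho> / 2" for k
  proof -
    \<comment> \<open>A unit step against \<open>\<Xi> k\<close> makes the linear term of the upper
      bound \<open>- norm (\<Xi> k)\<close>, also when \<open>\<Xi> k = 0\<close> since
      \<open>sgn 0 = 0\<close>; it stays in the ball of radius \<open>R + 1\<close>.\<close>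
    define w where "w = Y k - sgn (\<Xi> k)"
    have "norm w \<le> R + 1"
      using R[of k] norm_triangle_ineq4[of "Y k" "sgn (\<Xi> k)"] by (simp add: w_def norm_sgn split: if_splits)
    moreover have "norm (Y k) \<le> R + 1"
      using R[of k] by simp
    ultimately have "\<bar>p w\<bar> \<le> B" "\<bar>p (Y k)\<bar> \<le> B"
      using B by auto
    moreover have "p w \<le> p (Y k) + \<Xi> k \<bullet> (w - Y k) + \<rho> / 2 * (norm (w - Y k))\<^sup>2"
      by (rule limiting_subgradient_upper_bound[OF wc mem])
    moreover have "\<Xi> k \<bullet> (w - Y k) = - norm (\<Xi> k)"
      by (cases "\<Xi> k = 0") (simp_all add: w_def sgn_div_norm dot_square_norm power2_eq_square)
    moreover have "\<rho> / 2 * (norm (w - Y k))\<^sup>2 \<le> \<rho> / 2"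
      using wc by (simp add: w_def norm_sgn weakly_convex_def)
    ultimately show ?thesis
      by linarith
  qed
  then show ?thesis
    by (auto simp: bounded_iff)
qed

section \<open>Asymptotics of the iterates\<close>

text \<open>\<open>b\<close> is \<open>1 / \<beta>\<close> as a real number, with
  \<open>b = 0\<close> for an infinite \<open>\<beta>\<close>, in which case
  \<open>\<rho> = 0\<close> is forced. Since \<open>1 / ereal 0 = \<infinity>\<close>, a finite
  \<open>\<beta>\<close> with \<open>\<rho> = 0\<close> is treated separately.\<close>

lemma stepsize_reciprocal:
  fixes \<alpha> \<gamma> \<rho> :: real and \<beta> :: ereal
  assumes "0 < \<alpha>" "0 < \<gamma>" "0 < \<beta>" "0 \<le> \<rho>" "\<beta> \<le> 1 / ereal \<rho>"
    and "1 / ereal \<gamma> = 1 / ereal \<alpha> + 1 / \<beta>"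
  obtains b where "real_of_ereal (ereal \<gamma> / \<beta>) = \<gamma> * b" "1 / \<gamma> = 1 / \<alpha> + b" "\<rho> \<le> b"
proof (cases \<beta>)
  case (real r)
  then have "0 < r"
    using \<open>0 < \<beta>\<close> by simp
  moreover have "\<rho> \<le> 1 / r"
  proof (cases "\<rho> = 0")
    case False
    then have "r \<le> 1 / \<rho>"
      using assms(4,5) real by (simp add: one_ereal_def)
    then show ?thesis
      using False \<open>0 < r\<close> \<open>0 \<le> \<rho>\<close> by (simp add: field_simps)
  qed (use \<open>0 < r\<close> in simp)
  ultimately show thesis
    using that[of "1 / r"] assms(1,2,6) real by (simp add: one_ereal_def)
next
  case PInf
  then have "\<rho> = 0"
    using assms(4,5) by (cases "\<rho> = 0") (auto simp: one_ereal_def)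
  then show thesis
    using that[of 0] assms(1,2,6) PInf by (simp add: one_ereal_def)
qed (use assms(3) in simp)

text \<open>The weight \<open>1 / \<gamma>\<close> splits into \<open>1 / \<alpha>\<close>, which
  belongs to \<open>smooth_model\<close>, and \<open>b\<close>, which absorbs the curvature
  \<open>\<rho>\<close> of \<open>p\<close>.\<close>

lemma prox_step_descent:
  fixes f h p :: "'a::euclidean_space \<Rightarrow> real"
  assumes "0 < \<gamma>" and grad: "\<alpha> *\<^sub>R gradient f x = z - x" and "0 < \<alpha>"
    and b: "real_of_ereal (ereal \<gamma> / \<beta>) = \<gamma> * b" "1 / \<gamma> = 1 / \<alpha> + b" "\<rho> \<le> b"
    and mem: "y' \<in> prox \<gamma> g (forward_point h \<alpha> \<beta> \<gamma> x y z \<xi>)"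
    and g: "g y = ereal gy" "g y' = ereal gy'"
    and p: "p y' \<le> p y + \<xi> \<bullet> (y' - y) + \<rho> / 2 * (norm (y' - y))\<^sup>2"
  shows "smooth_model f h \<alpha> x y' + gy' + p y' \<le> smooth_model f h \<alpha> x y + gy + p y"
proof -
  define e where "e = y' - y"
  \<comment> \<open>The prox centre is \<open>\<gamma> *\<^sub>R q\<close>, so up to a constant the
    prox objective is \<open>g u\<close> plus \<open>(norm u)\<^sup>2 / (2 * \<gamma>)\<close> minus
    \<open>q \<bullet> u\<close>.\<close>
  define q where "q = (1 / \<alpha>) *\<^sub>R x - gradient f x - gradient h x + b *\<^sub>R y - \<xi>"
  define a where "a = 1 / \<alpha>"
  define v where "v = forward_point h \<alpha> \<beta> \<gamma> x y z \<xi>"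
  have z: "z = x + \<alpha> *\<^sub>R gradient f x"
    using grad by simp
  have v: "v = \<gamma> *\<^sub>R q"
    unfolding v_def forward_point_def b(1) q_def z using \<open>0 < \<alpha>\<close>
    by (simp add: algebra_simps scaleR_2)
  have "gy' + 1 / (2 * \<gamma>) * (norm (y' - v))\<^sup>2 \<le> gy + 1 / (2 * \<gamma>) * (norm (y - v))\<^sup>2"
    using proxD[OF mem, of y] by (simp add: g v_def)
  moreover have "1 / (2 * \<gamma>) * (norm (u - v))\<^sup>2
      = 1 / \<gamma> * ((norm u)\<^sup>2 / 2) - q \<bullet> u + 1 / (2 * \<gamma>) * (norm v)\<^sup>2" for u
  proof -
    have "(norm (u - v))\<^sup>2 = (norm u)\<^sup>2 - 2 * \<gamma> * (q \<bullet> u) + (norm v)\<^sup>2"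
      unfolding power2_norm_eq_inner v by (simp add: inner_diff inner_commute)
    then show ?thesis
      using \<open>0 < \<gamma>\<close> by (simp add: field_simps)
  qed
  ultimately have "gy' + (1 / \<alpha> + b) * ((norm y')\<^sup>2 / 2) - q \<bullet> y'
      \<le> gy + (1 / \<alpha> + b) * ((norm y)\<^sup>2 / 2) - q \<bullet> y"
    unfolding b(2) by simp
  moreover have q_e: "q \<bullet> y' - q \<bullet> y
      = 1 / \<alpha> * (x \<bullet> e) - (gradient f x + gradient h x) \<bullet> e + b * (y \<bullet> e) - \<xi> \<bullet> e"
    by (simp add: q_def e_def algebra_simps)
  moreover have "p y' \<le> p y + \<xi> \<bullet> e + b * ((norm e)\<^sup>2 / 2)"
    using p mult_right_mono[OF b(3), of "(norm e)\<^sup>2 / 2"] by (simp add: e_def)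
  moreover have "(norm e)\<^sup>2 / 2 = (norm y')\<^sup>2 / 2 - (norm y)\<^sup>2 / 2 - y \<bullet> e"
    unfolding e_def power2_norm_eq_inner by (simp add: inner_diff inner_commute)
  moreover have "smooth_model f h \<alpha> x y' - smooth_model f h \<alpha> x y
      = (gradient f x + gradient h x) \<bullet> e
        + 1 / \<alpha> * ((norm y')\<^sup>2 / 2 - (norm y)\<^sup>2 / 2 - x \<bullet> e)"
  proof -
    have norm_eq: "(norm (y' - x))\<^sup>2 = (norm (y - x))\<^sup>2 + 2 * ((norm y')\<^sup>2 / 2 - (norm y)\<^sup>2 / 2 - x \<bullet> e)"
      unfolding e_def power2_norm_eq_inner by (simp add: inner_diff inner_commute)
    show ?thesis
      unfolding smooth_model_def norm_eq using \<open>0 < \<alpha>\<close> by (simp add: e_def inner_diff_right field_simps)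
  qed
  ultimately show ?thesis
    unfolding a_def[symmetric] by (simp add: algebra_simps add_divide_distrib)
qed

lemma decrease_tendsto_zero_if_bounded_below_subsequence:
  fixes \<Phi> d :: "nat \<Rightarrow> real"
  assumes decr: "\<And>k. 1 \<le> k \<Longrightarrow> \<Phi> (Suc k) \<le> \<Phi> k - d k" and nonneg: "\<And>k. 0 \<le> d k"
    and "strict_mono r" and bound: "\<forall>\<^sub>F j in sequentially. B \<le> \<Phi> (r j)"
  shows "d \<longlonglongrightarrow> 0"
proof -
  \<comment> \<open>The decrease is available only from index \<open>1\<close> on; the shifted
    sequence is nonincreasing from its first term.\<close>
  define \<Psi> where "\<Psi> k = \<Phi> (Suc k)" for k
  have step: "\<Psi> (Suc k) \<le> \<Psi> k - d (Suc k)" for k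
    unfolding \<Psi>_def by (rule decr) simp
  have dec: "decseq \<Psi>"
  proof (rule decseq_SucI)
    show "\<Psi> (Suc k) \<le> \<Psi> k" for k
      using step[of k] nonneg[of "Suc k"] by simp
  qed
  have "B \<le> \<Psi> k" for k
  proof -
    have "\<forall>\<^sub>F j in sequentially. B \<le> \<Phi> (r j) \<and> Suc k \<le> j"
      using bound eventually_ge_at_top by (rule eventually_conj)
    then obtain j where j: "B \<le> \<Phi> (r j)" "Suc k \<le> j"
      by (auto dest: eventually_happens)
    then have "Suc k \<le> r j"
      using seq_suble[OF \<open>strict_mono r\<close>, of j] by simp
    then have "\<Phi> (r j) \<le> \<Psi> k"
      using decseqD[OF dec, of k "r j - 1"] by (simp add: \<Psi>_def)
    then show ?thesis
      using j by simp
  qed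
  then obtain l where l: "\<Psi> \<longlonglongrightarrow> l"
    using decseq_convergent[OF dec] by metis
  have lim: "(\<lambda>k. \<Psi> k - \<Psi> (Suc k)) \<longlonglongrightarrow> 0"
    using tendsto_diff[OF l LIMSEQ_Suc[OF l]] by simp
  have "norm (d (Suc k)) \<le> \<Psi> k - \<Psi> (Suc k)" for k
    using step[of k] nonneg[of "Suc k"] by simp
  then have "(\<lambda>k. d (Suc k)) \<longlonglongrightarrow> 0"
    by (intro Lim_null_comparison[OF _ lim] always_eventually allI)
  then show ?thesis
    by (rule LIMSEQ_imp_Suc)
qed

lemma generated_sequence_differences_tendsto_zero:
  fixes f h p :: "'a::euclidean_space \<Rightarrow> real"
  assumes f: "L_smooth Lf f" and h: "L_smooth Lh h"
    and g: "proper g" "lower_semicontinuous g"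
    and p: "weakly_convex \<rho>p (\<lambda>u. - p u)"
    and wc: "weakly_convex \<rho>f f" "\<rho>f \<le> Lf" and L: "0 < Lf + Lh"
    and \<beta>: "0 < \<beta>" "\<beta> \<le> 1 / ereal \<rho>p" and \<gamma>: "0 < \<gamma>" "1 / ereal \<gamma> = 1 / ereal \<alpha> + 1 / \<beta>"
    and adm: "admissible_pair f h Lf Lh \<rho>f \<tau> \<alpha>"
    and gen: "generated_sequence f g h p \<tau> \<alpha> \<beta> \<gamma> x y z"
    and r: "strict_mono r" "(\<lambda>j. x (r j)) \<longlonglongrightarrow> xs" "(\<lambda>j. y (r j)) \<longlonglongrightarrow> ys"
  shows "(\<lambda>k. x (Suc k) - x k) \<longlonglongrightarrow> 0" and "(\<lambda>k. y (Suc k) - x k) \<longlonglongrightarrow> 0"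
proof -
  have \<tau>: "0 < \<tau>" and \<alpha>: "0 < \<alpha>"
    using adm by (auto simp: admissible_pair_def)
  have \<rho>p: "0 \<le> \<rho>p"
    using p by (simp add: weakly_convex_def)
  obtain b where b: "real_of_ereal (ereal \<gamma> / \<beta>) = \<gamma> * b" "1 / \<gamma> = 1 / \<alpha> + b" "\<rho>p \<le> b"
    by (rule stepsize_reciprocal[OF \<alpha> \<gamma>(1) \<beta>(1) \<rho>p \<beta>(2) \<gamma>(2)])
  obtain \<kappa> where "0 < \<kappa>" and decrease:
    "\<And>x x' y. \<tau> *\<^sub>R (y - x) = (x' - x) + \<alpha> *\<^sub>R (gradient f x' - gradient f x) \<Longrightarrow>
      smooth_model f h \<alpha> x' y \<le> smooth_model f h \<alpha> x y - \<kappa> * (norm (x' - x))\<^sup>2"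
    by (rule admissible_pair_smooth_model_decrease[OF f h wc L adm]) (rule that; blast)
  have x_prox: "x k \<in> prox \<alpha> (\<lambda>u. ereal (f u)) (z k)"
    and y_prox: "\<exists>\<xi> \<in> limiting_subdifferential (\<lambda>u. ereal (p u)) (y k).
      y (Suc k) \<in> prox \<gamma> g (forward_point h \<alpha> \<beta> \<gamma> (x k) (y k) (z k) \<xi>)"
    and z_step: "z (Suc k) = z k + \<tau> *\<^sub>R (y (Suc k) - x k)" for k
    using gen by (auto simp: generated_sequence_def)
  have grad: "\<alpha> *\<^sub>R gradient f (x k) = z k - x k" for k
    by (rule prox_smooth_gradient[OF f \<alpha> x_prox])
  have step: "\<tau> *\<^sub>R (y (Suc k) - x k)
      = (x (Suc k) - x k) + \<alpha> *\<^sub>R (gradient f (x (Suc k)) - gradient f (x k))" for k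
    using z_step[of k] by (simp add: scaleR_diff_right grad algebra_simps)
  have g_Suc: "g (y (Suc k)) = ereal (real_of_ereal (g (y (Suc k))))" for k
    using y_prox[of k] proper_prox_finite[OF g(1)] by blast
  \<comment> \<open>At the arbitrary starting point \<open>y 0\<close> the value of \<open>g\<close>
    may be infinite. From index \<open>1\<close> on, \<open>y k\<close> is a prox point, so
    \<open>real_of_ereal\<close> preserves the value.\<close>
  have g_fin: "g (y k) = ereal (real_of_ereal (g (y k)))" if "1 \<le> k" for k
    using g_Suc[of "k - 1"] that by simp
  define \<Phi> where "\<Phi> k = smooth_model f h \<alpha> (x k) (y k) + real_of_ereal (g (y k)) + p (y k)" for k
  have decr: "\<Phi> (Suc k) \<le> \<Phi> k - \<kappa> * (norm (x (Suc k) - x k))\<^sup>2" if "1 \<le> k" for k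
  proof -
    obtain \<xi> where \<xi>: "\<xi> \<in> limiting_subdifferential (\<lambda>u. ereal (p u)) (y k)"
      and mem: "y (Suc k) \<in> prox \<gamma> g (forward_point h \<alpha> \<beta> \<gamma> (x k) (y k) (z k) \<xi>)"
      using y_prox by blast
    have "smooth_model f h \<alpha> (x k) (y (Suc k)) + real_of_ereal (g (y (Suc k))) + p (y (Suc k)) \<le> \<Phi> k"
      unfolding \<Phi>_def
      by (rule prox_step_descent[OF \<gamma>(1) grad \<alpha> b mem g_fin[OF that] g_Suc
            limiting_subgradient_upper_bound[OF p \<xi>]])
    then show ?thesis
      using decrease[OF step[of k]] by (simp add: \<Phi>_def)
  qed
  have "- \<infinity> < g ys"
    using g(1) by (auto simp: proper_def)
  \<comment> \<open>\<open>g ys\<close> may still be infinite here, so a real number below it serves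
    as the lower bound.\<close>
  then obtain c where c: "ereal c < g ys"
    using ereal_dense2 by blast
  define m where "m = smooth_model f h \<alpha> xs ys + p ys"
  have "continuous_on UNIV (gradient f)" "continuous_on UNIV (gradient h)"
    using f h by (auto simp: L_smooth_def)
  then have "(\<lambda>j. smooth_model f h \<alpha> (x (r j)) (y (r j)) + p (y (r j))) \<longlonglongrightarrow> m"
    unfolding smooth_model_def m_def
    by (intro tendsto_intros r(2,3) continuous_on_UNIV_tendsto[OF _ r(2)]
        continuous_on_UNIV_tendsto[OF _ r(3)] L_smooth_continuous[OF f] L_smooth_continuous[OF h]
        weakly_convex_continuous[OF p])
  then have "\<forall>\<^sub>F j in sequentially. m - 1 < smooth_model f h \<alpha> (x (r j)) (y (r j)) + p (y (r j))"
    by (rule order_tendstoD) simp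
  moreover have "\<forall>\<^sub>F j in sequentially. ereal c < g (y (r j))"
    by (rule lower_semicontinuous_eventually_gt[OF g(2) c r(3)])
  moreover have "\<forall>\<^sub>F j in sequentially. 1 \<le> j"
    by (rule eventually_ge_at_top)
  ultimately have "\<forall>\<^sub>F j in sequentially. m - 1 + c \<le> \<Phi> (r j)"
  proof eventually_elim
    case (elim j)
    then have "1 \<le> r j"
      using seq_suble[OF r(1), of j] by simp
    from elim(2) have "c < real_of_ereal (g (y (r j)))"
      by (subst (asm) g_fin[OF \<open>1 \<le> r j\<close>]) simp
    then show ?case
      using elim(1) by (simp add: \<Phi>_def)
  qed
  then have "(\<lambda>k. \<kappa> * (norm (x (Suc k) - x k))\<^sup>2) \<longlonglongrightarrow> 0"
    using \<open>0 < \<kappa>\<close> decr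
    by (intro decrease_tendsto_zero_if_bounded_below_subsequence[where \<Phi> = \<Phi>, OF _ _ r(1)]) auto
  then have "(\<lambda>k. sqrt (1 / \<kappa> * (\<kappa> * (norm (x (Suc k) - x k))\<^sup>2))) \<longlonglongrightarrow> sqrt (1 / \<kappa> * 0)"
    by (intro tendsto_intros)
  then have x_norm: "(\<lambda>k. norm (x (Suc k) - x k)) \<longlonglongrightarrow> 0"
    using \<open>0 < \<kappa>\<close> by simp
  then show x_diff: "(\<lambda>k. x (Suc k) - x k) \<longlonglongrightarrow> 0"
    by (rule tendsto_norm_zero_cancel)
  have grad_diff: "(\<lambda>k. gradient f (x (Suc k)) - gradient f (x k)) \<longlonglongrightarrow> 0"
  proof (rule Lim_null_comparison)
    show "\<forall>\<^sub>F k in sequentially. norm (gradient f (x (Suc k)) - gradient f (x k))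
        \<le> Lf * norm (x (Suc k) - x k)"
      by (intro always_eventually allI lipschitz_on_norm_le L_smooth_lipschitz[OF f])
    show "(\<lambda>k. Lf * norm (x (Suc k) - x k)) \<longlonglongrightarrow> 0"
      by (rule tendsto_mult_right_zero[OF x_norm])
  qed
  have "(\<lambda>k. (1 / \<tau>) *\<^sub>R ((x (Suc k) - x k) + \<alpha> *\<^sub>R (gradient f (x (Suc k)) - gradient f (x k))))
      \<longlonglongrightarrow> (1 / \<tau>) *\<^sub>R (0 + \<alpha> *\<^sub>R 0)"
    by (intro tendsto_intros x_diff grad_diff)
  then show "(\<lambda>k. y (Suc k) - x k) \<longlonglongrightarrow> 0"
    unfolding step[symmetric] using \<tau> by simp
qed

theorem theorem3p18:
  fixes f h p :: "real ^ 'n \<Rightarrow> real"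
    and g :: "real ^ 'n \<Rightarrow> ereal"
    and Lf Lh \<rho>f \<rho>p \<tau> \<alpha> \<gamma> :: real
    and \<beta> :: ereal
    and x y z :: "nat \<Rightarrow> real ^ 'n"
    and xs ys zs :: "real ^ 'n"
  assumes "L_smooth Lf f"
    and "proper g" and "lower_semicontinuous g"
    and "L_smooth Lh h"
    and "\<exists>U. open U \<and> domain g \<subseteq> U \<and> continuous_on U p"
    and "weakly_convex \<rho>p (\<lambda>u. - p u)"
    and "bounded_level_sets (\<lambda>u. ereal (f u) + g u + ereal (h u) + ereal (p u))"
    and "Lf + Lh > 0"
    and "weakly_convex \<rho>f f" and "\<rho>f \<le> Lf"
    and "0 < \<beta>" and "\<beta> \<le> 1 / ereal \<rho>p"
    and "0 < \<gamma>" and "1 / ereal \<gamma> = 1 / ereal \<alpha> + 1 / \<beta>"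
    and "admissible_pair f h Lf Lh \<rho>f \<tau> \<alpha>"
    and "generated_sequence f g h p \<tau> \<alpha> \<beta> \<gamma> x y z"
    and "\<exists>r::nat \<Rightarrow> nat. strict_mono r \<and> (\<lambda>j. (x (r j), y (r j), z (r j))) \<longlonglongrightarrow> (xs, ys, zs)"
  shows "xs = ys \<and> (ys, zs) \<in> Fix (T_op f g h p \<tau> \<alpha> \<beta> \<gamma>)"
proof -
  obtain r :: "nat \<Rightarrow> nat" where r: "strict_mono r"
    and lim: "(\<lambda>j. (x (r j), y (r j), z (r j))) \<longlonglongrightarrow> (xs, ys, zs)"
    using assms(17) by blast
  have x_lim: "(\<lambda>j. x (r j)) \<longlonglongrightarrow> xs" and y_lim: "(\<lambda>j. y (r j)) \<longlonglongrightarrow> ys"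
    and z_lim: "(\<lambda>j. z (r j)) \<longlonglongrightarrow> zs"
    using tendsto_fst[OF lim] tendsto_fst[OF tendsto_snd[OF lim]] tendsto_snd[OF tendsto_snd[OF lim]]
    by simp_all
  note diffs = generated_sequence_differences_tendsto_zero[OF assms(1,4,2,3,6,9,10,8,11-16)
      r x_lim y_lim]
  have "(\<lambda>k. (y (Suc k) - x k) - (x (Suc k) - x k)) \<longlonglongrightarrow> 0 - 0"
    by (intro tendsto_diff diffs)
  then have "(\<lambda>k. y (Suc k) - x (Suc k)) \<longlonglongrightarrow> 0"
    by simp
  then have "(\<lambda>k. y k - x k) \<longlonglongrightarrow> 0"
    by (rule LIMSEQ_imp_Suc)
  from LIMSEQ_subseq_LIMSEQ[OF this r] have "(\<lambda>j. y (r j) - x (r j)) \<longlonglongrightarrow> 0"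
    by (simp add: o_def)
  moreover have "(\<lambda>j. y (r j) - x (r j)) \<longlonglongrightarrow> ys - xs"
    by (intro tendsto_diff x_lim y_lim)
  ultimately have "0 = ys - xs"
    by (rule LIMSEQ_unique)
  then have eq: "xs = ys"
    by simp
  \<comment> \<open>The prox inclusion at index \<open>r j\<close> has \<open>y (Suc (r j))\<close>
    as its output, so the successors must be shown to have the same limit.\<close>
  have "(\<lambda>j. y (Suc (r j)) - x (r j)) \<longlonglongrightarrow> 0"
    using LIMSEQ_subseq_LIMSEQ[OF diffs(2) r] by (simp add: o_def)
  from tendsto_add[OF this x_lim] have y_Suc_lim: "(\<lambda>j. y (Suc (r j))) \<longlonglongrightarrow> ys"
    by (simp add: eq)
  have x_prox: "\<And>k. x k \<in> prox \<alpha> (\<lambda>u. ereal (f u)) (z k)"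
    and "\<forall>k. \<exists>\<xi>. \<xi> \<in> limiting_subdifferential (\<lambda>u. ereal (p u)) (y k) \<and>
      y (Suc k) \<in> prox \<gamma> g (forward_point h \<alpha> \<beta> \<gamma> (x k) (y k) (z k) \<xi>)"
    using assms(16) by (auto simp: generated_sequence_def)
  then obtain \<xi> where \<xi>: "\<And>k. \<xi> k \<in> limiting_subdifferential (\<lambda>u. ereal (p u)) (y k)"
    and y_prox: "\<And>k. y (Suc k) \<in> prox \<gamma> g (forward_point h \<alpha> \<beta> \<gamma> (x k) (y k) (z k) (\<xi> k))"
    by metis
  have "bounded (range (\<lambda>j. \<xi> (r j)))"
    by (rule limiting_subgradients_bounded[OF assms(6) y_lim \<xi>])
  \<comment> \<open>The subgradients are only known to be bounded along \<open>r\<close>, hence a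
    further subsequence \<open>s\<close>.\<close>
  then obtain \<zeta> s where s: "strict_mono s" and \<xi>_lim: "((\<lambda>j. \<xi> (r j)) \<circ> s) \<longlonglongrightarrow> \<zeta>"
    using bounded_imp_convergent_subsequence by blast
  note sub = LIMSEQ_subseq_LIMSEQ[OF _ s, unfolded o_def]
  have \<xi>_lim: "(\<lambda>j. \<xi> (r (s j))) \<longlonglongrightarrow> \<zeta>"
    using \<xi>_lim by (simp add: o_def)
  have \<zeta>: "\<zeta> \<in> limiting_subdifferential (\<lambda>u. ereal (p u)) ys"
    by (rule limiting_subdifferential_closed_graph[OF weakly_convex_continuous[OF assms(6)]
          sub[OF y_lim] \<xi>_lim \<xi>])
  have "proper (\<lambda>u. ereal (f u))"
    by (simp add: proper_def domain_def)
  with continuous_imp_lower_semicontinuous[OF L_smooth_continuous[OF assms(1)]]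
  have xs: "xs \<in> prox \<alpha> (\<lambda>u. ereal (f u)) zs"
    using x_lim z_lim x_prox by (rule prox_closed_graph)
  have cont: "continuous_on UNIV (gradient h)"
    using assms(4) by (simp add: L_smooth_def)
  have "(\<lambda>j. forward_point h \<alpha> \<beta> \<gamma> (x (r (s j))) (y (r (s j))) (z (r (s j))) (\<xi> (r (s j))))
      \<longlonglongrightarrow> forward_point h \<alpha> \<beta> \<gamma> xs ys zs \<zeta>"
    unfolding forward_point_def
    by (intro tendsto_intros sub[OF x_lim] sub[OF y_lim] sub[OF z_lim] \<xi>_lim
        continuous_on_UNIV_tendsto[OF cont sub[OF x_lim]])
  with assms(3,2) sub[OF y_Suc_lim]
  have "ys \<in> prox \<gamma> g (forward_point h \<alpha> \<beta> \<gamma> xs ys zs \<zeta>)"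
    using y_prox by (rule prox_closed_graph)
  with xs \<zeta> have "ys \<in> P_op f g h p \<alpha> \<beta> \<gamma> (ys, zs)"
    by (auto simp: P_op_def)
  moreover have "(ys, zs) = (ys, zs + \<tau> *\<^sub>R (ys - xs))"
    by (simp add: eq)
  ultimately have "(ys, zs) \<in> T_op f g h p \<tau> \<alpha> \<beta> \<gamma> (ys, zs)"
    unfolding T_op_def using xs by blast
  then show ?thesis
    using eq by (simp add: Fix_def)
qed

end
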